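(* Let $\mathcal H$ be a finite-dimensional complex Hilbert space, let $T\in\mathcal B(\mathcal H)$ and let $m\ge1$ be an odd integer. The following are equivalent. (a) $T$ is similar to an $m$-isometry. (b) There is an equivalent Hilbert norm on $\mathcal H$ with respect to which $T$ is an $m$-isometry. (c) $T$ is invertible and $\displaystyle\sup_{n\in\mathbb Z\setminus\{0\}}\frac{\|T^n\|^2}{|n|^{m-1}}<\infty$. (d) $\sigma(T)\subseteq\{z\in\mathbb C:|z|=1\}$ and the maximum Jordan block size of $T$ is at most $\frac{m+1}{2}$.
   Context: $\mathcal B(\mathcal H)$ denotes the (bounded) linear operators on $\mathcal H$. For $T\in\mathcal B(\mathcal H)$ and an integer $m\ge1$, let $\beta_m(T)=\sum_{k=0}^m(-1)^{m-k}\binom mk T^{*k}T^k$; $T$ is an $m$-isometry if $\beta_m(T)=0$, equivalently $\sum_{k=0}^m(-1)^{m-k}\binom mk\|T^kx\|^2=0$ for all $x\in\mathcal H$. $T$ is an $m$-isometry with respect to another Hilbert norm (a norm induced by an inner product) if this holds with that norm (and the adjoint taken for its inner product). Two operators $A,B$ are similar if $A=P^{-1}BP$ for some invertible $P\in\mathcal B(\mathcal H)$. $\sigma(T)$ is the spectrum of $T$. *)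

theory Defs
  imports "HOL-Library.Extended_Real" "Jordan_Normal_Form.Jordan_Normal_Form"
begin

text \<open>
  A finite-dimensional complex Hilbert space is a type \<open>'a\<close> with a scalar multiplication
  \<open>scale\<close> satisfying \<open>finite_dimensional_vector_space\<close> and an inner product \<open>ip\<close>; both are explicit
  parameters because several inner products on the same vector space have to be considered.
  Completeness, and boundedness of linear operators, are automatic in finite dimension, so the
  elements of $\mathcal B(\mathcal H)$ are the maps satisfying \<open>Vector_Spaces.linear scale scale\<close>.
\<close>

locale complex_inner_product = vector_space scale
  for scale :: "complex \<Rightarrow> 'a::ab_group_add \<Rightarrow> 'a" +
  fixes ip :: "'a \<Rightarrow> 'a \<Rightarrow> complex"
  assumes ip_add_left: "ip (x + y) z = ip x z + ip y z"
    and ip_scale_left: "ip (scale c x) y = c * ip x y"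
    and ip_commute: "ip y x = cnj (ip x y)"
    and ip_pos: "x \<noteq> 0 \<Longrightarrow> 0 < Re (ip x x)"

definition ip_norm :: "('a \<Rightarrow> 'a \<Rightarrow> complex) \<Rightarrow> 'a \<Rightarrow> real" where
  "ip_norm ip x = sqrt (Re (ip x x))"

definition equivalent_norms :: "('a \<Rightarrow> real) \<Rightarrow> ('a \<Rightarrow> real) \<Rightarrow> bool" where
  "equivalent_norms N N' \<longleftrightarrow> (\<exists>c>0. \<exists>C>0. \<forall>x. c * N x \<le> N' x \<and> N' x \<le> C * N x)"

text \<open>In finite dimension the set is bounded above for linear \<open>T\<close>, so the real supremum is the
  true one.\<close>

definition op_norm :: "('a \<Rightarrow> 'a \<Rightarrow> complex) \<Rightarrow> ('a \<Rightarrow> 'a) \<Rightarrow> real" where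
  "op_norm ip T = Sup {ip_norm ip (T x) | x. ip_norm ip x \<le> 1}"

definition hadjoint :: "('a \<Rightarrow> 'a \<Rightarrow> complex) \<Rightarrow> ('a \<Rightarrow> 'a) \<Rightarrow> 'a \<Rightarrow> 'a" where
  "hadjoint ip T = (THE S. \<forall>x y. ip (T x) y = ip x (S y))"

definition beta_op ::
  "(complex \<Rightarrow> 'a::ab_group_add \<Rightarrow> 'a) \<Rightarrow> ('a \<Rightarrow> 'a \<Rightarrow> complex) \<Rightarrow> nat \<Rightarrow> ('a \<Rightarrow> 'a) \<Rightarrow> 'a \<Rightarrow> 'a" where
  "beta_op scale ip m T x =
     (\<Sum>k\<le>m. scale ((-1) ^ (m - k) * of_nat (m choose k)) ((hadjoint ip T ^^ k) ((T ^^ k) x)))"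

definition m_isometry ::
  "(complex \<Rightarrow> 'a::ab_group_add \<Rightarrow> 'a) \<Rightarrow> ('a \<Rightarrow> 'a \<Rightarrow> complex) \<Rightarrow> nat \<Rightarrow> ('a \<Rightarrow> 'a) \<Rightarrow> bool" where
  "m_isometry scale ip m T \<longleftrightarrow>
     Vector_Spaces.linear scale scale T \<and> (\<forall>x. beta_op scale ip m T x = 0)"

definition invertible_op :: "(complex \<Rightarrow> 'a::ab_group_add \<Rightarrow> 'a) \<Rightarrow> ('a \<Rightarrow> 'a) \<Rightarrow> bool" where
  "invertible_op scale T \<longleftrightarrow> Vector_Spaces.linear scale scale T \<and>
     (\<exists>S. Vector_Spaces.linear scale scale S \<and> S \<circ> T = id \<and> T \<circ> S = id)"

definition similar_op ::
  "(complex \<Rightarrow> 'a::ab_group_add \<Rightarrow> 'a) \<Rightarrow> ('a \<Rightarrow> 'a) \<Rightarrow> ('a \<Rightarrow> 'a) \<Rightarrow> bool" where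
  "similar_op scale A B \<longleftrightarrow> (\<exists>P. invertible_op scale P \<and> A = inv_into UNIV P \<circ> B \<circ> P)"

text \<open>Integer powers; for negative exponents only meaningful when \<open>T\<close> is bijective.\<close>

definition op_powi :: "('a \<Rightarrow> 'a) \<Rightarrow> int \<Rightarrow> 'a \<Rightarrow> 'a" where
  "op_powi T n = (if n \<ge> 0 then T ^^ nat n else inv_into UNIV T ^^ nat (- n))"

definition op_spectrum :: "(complex \<Rightarrow> 'a::ab_group_add \<Rightarrow> 'a) \<Rightarrow> ('a \<Rightarrow> 'a) \<Rightarrow> complex set" where
  "op_spectrum scale T = {z. \<not> invertible_op scale (\<lambda>x. T x - scale z x)}"

definition is_basis :: "(complex \<Rightarrow> 'a::ab_group_add \<Rightarrow> 'a) \<Rightarrow> 'a list \<Rightarrow> bool" where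
  "is_basis scale bs \<longleftrightarrow>
     distinct bs \<and> \<not> module.dependent scale (set bs) \<and> module.span scale (set bs) = UNIV"

text \<open>The \<open>j\<close>-th column holds the coordinates of the image of the \<open>j\<close>-th basis vector.\<close>

definition op_matrix ::
  "(complex \<Rightarrow> 'a::ab_group_add \<Rightarrow> 'a) \<Rightarrow> 'a list \<Rightarrow> ('a \<Rightarrow> 'a) \<Rightarrow> complex mat" where
  "op_matrix scale bs T = mat (length bs) (length bs)
     (\<lambda>(i, j). module.representation scale (set bs) (T (bs ! j)) (bs ! i))"

text \<open>The sizes of the blocks in the Jordan normal forms of \<open>T\<close>. The multiset of blocks does not
  depend on the chosen basis or on the chosen normal form, hence neither does the set of sizes.
  On the zero space there are no blocks and the maximum is \<open>0\<close>.\<close>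

definition jordan_block_sizes :: "(complex \<Rightarrow> 'a::ab_group_add \<Rightarrow> 'a) \<Rightarrow> ('a \<Rightarrow> 'a) \<Rightarrow> nat set" where
  "jordan_block_sizes scale T =
     {k. \<exists>bs n_as a. is_basis scale bs \<and> jordan_nf (op_matrix scale bs T) n_as \<and> (k, a) \<in> set n_as}"

definition max_jordan_block_size :: "(complex \<Rightarrow> 'a::ab_group_add \<Rightarrow> 'a) \<Rightarrow> ('a \<Rightarrow> 'a) \<Rightarrow> nat" where
  "max_jordan_block_size scale T = Max (insert 0 (jordan_block_sizes scale T))"

end

(* Let F n be the form ip (T^n x) (T^n y). By the binomial formula T is an m-isometry iff the m-th
   forward difference of F vanishes at 0, for all x and y, and hence everywhere: iff F is a
   polynomial in n of degree less than m. So the powers of an m-isometry, and those of its inverse,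
   which is an m-isometry too, grow at most like n^((m-1)/2). Such growth in both directions puts
   the eigenvalues on the unit circle, and since a k-by-k Jordan block with eigenvalue a has the
   entry binom(n,k-1) a^(n-k+1) in its n-th power, it bounds k-1 by (m-1)/2. Conversely, declare a
   Jordan basis orthonormal: the entries in row i of the n-th power of the Jordan matrix are a_i^n
   times polynomials in n of degree at most (m-1)/2, and the unimodular factors cancel in F.
   Similarity is the same as a change of inner product, because any two inner products of a
   finite-dimensional space are intertwined by a map between orthonormal bases. *)

theory Submission
  imports Defs "Jordan_Normal_Form.Jordan_Normal_Form_Existence"
begin

subsection \<open>Finite differences\<close>

text \<open>Oddness of m enters through m = 2 * r + 1. The bound n^(m-1) on squared norms is then
  the square of n^r, so the integer r bounds k - 1 for every block size k; conversely a product of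
  two polynomials of degree at most r has degree at most 2 * r, which is below m. The obstacle is
  that the growth condition lives in the given norm, whereas the entries of powers live in Jordan
  coordinates, and a Jordan basis is in general not orthonormal for \<open>ip\<close>. Finite
  dimension bridges the two: coordinate functionals, and the identity between two inner product
  spaces, are bounded with constants read off from an orthonormal basis. For the same reason (d)
  leads back to (b), where the inner product may be chosen. \<open>jordan_block_sizes\<close> ranges
  over all bases and all normal forms. Hence the growth estimate treats an arbitrary form, while the
  construction of the inner product starts from a single one. Estimates stay squared because squared
  norms along an orbit are the values of F on the diagonal x = y.\<close>

definition fdiff :: "(nat \<Rightarrow> 'a::ab_group_add) \<Rightarrow> nat \<Rightarrow> 'a" where
  "fdiff f n = f (Suc n) - f n"

text \<open>At n = 0 the right-hand side has the coefficients of \<open>beta_op\<close>. The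
  induction is Pascal's rule: taking the difference first splits the sum into a shifted and an
  unshifted copy.\<close>

lemma fdiff_funpow:
  fixes f :: "nat \<Rightarrow> 'a::comm_ring_1"
  shows "(fdiff ^^ m) f n = (\<Sum>k\<le>m. (-1) ^ (m - k) * of_nat (m choose k) * f (n + k))"
proof (induction m arbitrary: f)
  case 0
  then show ?case by simp
next
  case (Suc m)
  let ?c = "\<lambda>k. (-1) ^ (m - k) * of_nat (m choose k) :: 'a"
  have shift: "(\<Sum>k\<le>m. ?c k * f (n + k)) =
      (-1) ^ m * f n + (\<Sum>k\<le>m. (-1) ^ (m - Suc k) * of_nat (m choose Suc k) * f (n + Suc k))"
  proof -
    have "(\<Sum>k\<le>m. ?c k * f (n + k)) = (\<Sum>k\<le>Suc m. ?c k * f (n + k))"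
      by (simp add: binomial_eq_0)
    also have "\<dots> = (-1) ^ m * f n + (\<Sum>k\<le>m. ?c (Suc k) * f (n + Suc k))"
      by (subst sum.atMost_Suc_shift) simp
    finally show ?thesis .
  qed
  \<comment> \<open>For k >= m both truncated exponents are 0 and the signs would not be opposite,
    but there the binomial coefficient vanishes.\<close>
  have neg: "(-1) ^ (m - Suc k) * of_nat (m choose Suc k) = - ((-1) ^ (m - k) * of_nat (m choose Suc k) :: 'a)"
    for k
  proof (cases "k < m")
    case True
    then have "m - k = Suc (m - Suc k)" by simp
    then show ?thesis by simp
  qed (simp add: binomial_eq_0)
  have "(fdiff ^^ Suc m) f n = (\<Sum>k\<le>m. ?c k * fdiff f (n + k))"
    using Suc[of "fdiff f"] by (simp add: funpow_Suc_right del: funpow.simps)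
  also have "\<dots> = (\<Sum>k\<le>m. ?c k * f (n + Suc k)) - (\<Sum>k\<le>m. ?c k * f (n + k))"
    by (simp add: fdiff_def algebra_simps sum_subtractf)
  also have "\<dots> = (-1) ^ Suc m * f n
      + (\<Sum>k\<le>m. (-1) ^ (m - k) * of_nat (Suc m choose Suc k) * f (n + Suc k))"
    unfolding shift neg by (simp add: algebra_simps sum.distrib sum_negf)
  also have "\<dots> = (\<Sum>k\<le>Suc m. (-1) ^ (Suc m - k) * of_nat (Suc m choose k) * f (n + k))"
    by (subst sum.atMost_Suc_shift) simp
  finally show ?case .
qed

lemma fdiff_funpow_shift:
  fixes f :: "nat \<Rightarrow> 'a::comm_ring_1"
  shows "(fdiff ^^ m) (\<lambda>k. f (n + k)) 0 = (fdiff ^^ m) f n"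
  by (simp add: fdiff_funpow)

lemma fdiff_funpow_cong:
  fixes f g :: "nat \<Rightarrow> 'a::comm_ring_1"
  assumes "\<And>k. k \<le> m \<Longrightarrow> f k = g k"
  shows "(fdiff ^^ m) f 0 = (fdiff ^^ m) g 0"
  using assms by (simp add: fdiff_funpow)

text \<open>Binomial coefficients are symmetric under k to m - k, and the signs change by the common
  factor (-1)^m. This carries the difference equation over to the inverse operator.\<close>

lemma fdiff_funpow_reverse:
  fixes f :: "nat \<Rightarrow> 'a::comm_ring_1"
  shows "(fdiff ^^ m) (\<lambda>k. f (m - k)) 0 = (-1) ^ m * (fdiff ^^ m) f 0"
proof -
  have eq: "(-1) ^ k = (-1) ^ m * ((-1) ^ (m - k) :: 'a)" if "k \<le> m" for k
  proof -
    have "m + (m - k) = k + 2 * (m - k)"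
      using that by simp
    then have "(-1) ^ m * ((-1) ^ (m - k) :: 'a) = (-1) ^ (k + 2 * (m - k))"
      by (metis power_add)
    then show ?thesis by (simp add: power_add power_mult)
  qed
  have "(fdiff ^^ m) (\<lambda>k. f (m - k)) 0 = (\<Sum>k\<le>m. (-1) ^ (m - k) * of_nat (m choose k) * f (m - k))"
    by (simp add: fdiff_funpow)
  also have "\<dots> = (\<Sum>k\<le>m. (-1) ^ k * of_nat (m choose k) * f k)"
    by (rule sum.reindex_bij_witness[of _ "\<lambda>k. m - k" "\<lambda>k. m - k"])
      (auto simp: binomial_symmetric[symmetric])
  also have "\<dots> = (-1) ^ m * (fdiff ^^ m) f 0"
    unfolding fdiff_funpow sum_distrib_left by (intro sum.cong) (simp_all add: eq[symmetric] flip: mult.assoc)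
  finally show ?thesis .
qed

text \<open>Newton's forward series: the shift is the identity plus \<open>fdiff\<close>, so its
  n-th power expands binomially.\<close>

lemma newton_forward:
  fixes f :: "nat \<Rightarrow> 'a::comm_ring_1"
  shows "f n = (\<Sum>j\<le>n. of_nat (n choose j) * (fdiff ^^ j) f 0)"
proof (induction n arbitrary: f)
  case 0
  then show ?case by simp
next
  case (Suc n)
  have "f (Suc n) = f n + fdiff f n"
    by (simp add: fdiff_def)
  also have "f n = (\<Sum>j\<le>Suc n. of_nat (n choose j) * (fdiff ^^ j) f 0)"
    using Suc[of f] by (simp add: binomial_eq_0)
  also have "\<dots> = f 0 + (\<Sum>j\<le>n. of_nat (n choose Suc j) * (fdiff ^^ Suc j) f 0)"
    by (subst sum.atMost_Suc_shift) simp
  also have "fdiff f n = (\<Sum>j\<le>n. of_nat (n choose j) * (fdiff ^^ Suc j) f 0)"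
    using Suc[of "fdiff f"] by (simp add: funpow_Suc_right del: funpow.simps)
  also have "f 0 + (\<Sum>j\<le>n. of_nat (n choose Suc j) * (fdiff ^^ Suc j) f 0)
      + (\<Sum>j\<le>n. of_nat (n choose j) * (fdiff ^^ Suc j) f 0)
      = f 0 + (\<Sum>j\<le>n. of_nat (Suc n choose Suc j) * (fdiff ^^ Suc j) f 0)"
    by (simp add: algebra_simps sum.distrib)
  also have "\<dots> = (\<Sum>j\<le>Suc n. of_nat (Suc n choose j) * (fdiff ^^ j) f 0)"
    by (subst sum.atMost_Suc_shift) simp
  finally show ?case .
qed

lemma norm_fdiff_funpow_le:
  fixes f :: "nat \<Rightarrow> complex"
  assumes "\<And>k. k \<le> j \<Longrightarrow> norm (f k) \<le> M"
  shows "norm ((fdiff ^^ j) f 0) \<le> 2 ^ j * M"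
proof -
  have "norm ((fdiff ^^ j) f 0) \<le> (\<Sum>k\<le>j. real (j choose k) * M)"
    unfolding fdiff_funpow
    by (rule sum_norm_le) (use assms in \<open>auto simp: norm_mult norm_power intro!: mult_left_mono\<close>)
  also have "\<dots> = 2 ^ j * M"
    by (simp flip: sum_distrib_right of_nat_sum add: choose_row_sum)
  finally show ?thesis .
qed

lemma fdiff_zero: "fdiff (\<lambda>_. 0) = (\<lambda>_. 0)"
  by (simp add: fdiff_def fun_eq_iff)

lemma fdiff_funpow_zero: "(fdiff ^^ j) (\<lambda>_. 0) = (\<lambda>_. 0)"
  by (induction j) (simp_all add: fdiff_zero)

text \<open>Newton's series stops before order m. Each of its m terms is a difference of size at
  most 2^m * M times a binomial coefficient of size at most n^(m-1).\<close>

lemma norm_le_of_fdiff_funpow_eq_0: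
  fixes f :: "nat \<Rightarrow> complex"
  assumes "\<And>n. (fdiff ^^ m) f n = 0"
    and M: "\<And>k. k < m \<Longrightarrow> norm (f k) \<le> M"
    and "n \<ge> 1" "M \<ge> 0"
  shows "norm (f n) \<le> real m * 2 ^ m * M * real n ^ (m - 1)"
proof -
  have zero: "(fdiff ^^ j) f 0 = 0" if "m \<le> j" for j
  proof -
    have "(fdiff ^^ j) f = (fdiff ^^ (j - m)) ((fdiff ^^ m) f)"
      using that by (metis comp_apply funpow_add le_add_diff_inverse2)
    also have "(fdiff ^^ m) f = (\<lambda>_. 0)"
      using assms(1) by blast
    finally show ?thesis by (simp add: fdiff_funpow_zero)
  qed
  have "f n = (\<Sum>j\<in>{..n}. of_nat (n choose j) * (fdiff ^^ j) f 0)"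
    by (rule newton_forward)
  also have "\<dots> = (\<Sum>j<m. of_nat (n choose j) * (fdiff ^^ j) f 0)"
    \<comment> \<open>Both cut-offs are absorbed: terms with j >= m have vanishing difference, terms
      with j > n vanishing binomial coefficient.\<close>
    by (rule sum.mono_neutral_cong) (auto simp: zero binomial_eq_0)
  finally have "norm (f n) \<le> (\<Sum>j<m. 2 ^ m * M * real n ^ (m - 1))"
  proof (simp only:, intro sum_norm_le)
    fix j assume "j \<in> {..<m}"
    then have j: "j < m" by simp
    have "norm ((fdiff ^^ j) f 0) \<le> 2 ^ j * M"
      using j by (intro norm_fdiff_funpow_le M) simp
    also have "\<dots> \<le> 2 ^ m * M"
      using j \<open>M \<ge> 0\<close> by (intro mult_right_mono power_increasing) auto
    finally have 1: "norm ((fdiff ^^ j) f 0) \<le> 2 ^ m * M" .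
    have "n choose j \<le> n ^ j"
      by (cases "j \<le> n") (auto simp: binomial_le_pow binomial_eq_0)
    also have "\<dots> \<le> n ^ (m - 1)"
      using j \<open>n \<ge> 1\<close> by (intro power_increasing) auto
    finally have 2: "real (n choose j) \<le> real n ^ (m - 1)"
      by (metis of_nat_le_iff of_nat_power)
    have "norm (of_nat (n choose j) * (fdiff ^^ j) f 0)
        \<le> real n ^ (m - 1) * (2 ^ m * M)"
      unfolding norm_mult using 1 2 by (intro mult_mono) auto
    then show "norm (of_nat (n choose j) * (fdiff ^^ j) f 0) \<le> 2 ^ m * M * real n ^ (m - 1)"
      by (simp add: mult.commute)
  qed
  then show ?thesis by (simp add: mult_ac)
qed

text \<open>p(X + 1) and p have the same leading coefficient, so each difference lowers the degree
  of a nonconstant polynomial and kills a constant.\<close>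

lemma fdiff_funpow_poly:
  fixes p :: "'a::idom poly"
  assumes "degree p < m"
  shows "(fdiff ^^ m) (\<lambda>n. poly p (of_nat n)) = (\<lambda>_. 0)"
  using assms
proof (induction m arbitrary: p)
  case 0
  then show ?case by simp
next
  case (Suc m)
  define q where "q = p \<circ>\<^sub>p [:1, 1:] - p"
  have q: "fdiff (\<lambda>n. poly p (of_nat n)) = (\<lambda>n. poly q (of_nat n))"
    by (simp add: fun_eq_iff fdiff_def q_def poly_pcompose)
  show ?case
  proof (cases "degree p = 0")
    case True
    then obtain c where "p = [:c:]" by (meson degree_eq_zeroE)
    then have "q = 0" by (simp add: q_def)
    then show ?thesis
      by (simp add: funpow_Suc_right q fdiff_funpow_zero del: funpow.simps)
  next
    case False
    have "degree (p \<circ>\<^sub>p [:1, 1:]) = degree p"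
      by (simp add: degree_pcompose)
    moreover have "coeff (p \<circ>\<^sub>p [:1, 1:]) (degree p) = coeff p (degree p)"
      using lead_coeff_comp[of "[:1, 1:]" p] calculation by simp
    ultimately have "coeff q (degree p) = 0" "degree q \<le> degree p"
      using degree_diff_le[of "p \<circ>\<^sub>p [:1, 1:]" "degree p" p] by (simp_all add: q_def)
    then have "degree q < degree p"
      using False by (metis le_neq_implies_less leading_coeff_0_iff degree_0)
    then show ?thesis
      using Suc by (simp add: funpow_Suc_right q del: funpow.simps)
  qed
qed

text \<open>The polynomial is X (X - 1) ... (X - d + 1) / d!. It also vanishes at the naturals below
  d, so the formula holds for every n.\<close>

lemma binomial_poly:
  obtains p :: "complex poly" where "degree p \<le> d" "\<And>n. of_nat (n choose d) = poly p (of_nat n)"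
proof
  let ?p = "Polynomial.smult (inverse (fact d)) (\<Prod>i = 0..<d. [:- of_nat i, 1:]) :: complex poly"
  have "degree (\<Prod>i = 0..<d. [:- of_nat i, 1:] :: complex poly) \<le> (\<Sum>i = 0..<d. 1)"
    using degree_prod_sum_le[of "{0..<d}" "\<lambda>i. [:- of_nat i, 1:] :: complex poly"] by simp
  then show "degree ?p \<le> d" by simp
  show "of_nat (n choose d) = poly ?p (of_nat n)" for n
    by (simp add: binomial_gbinomial gbinomial_prod_rev poly_prod divide_inverse mult.commute)
qed

text \<open>The lower bound (n/d)^d for the binomial coefficient shows that it grows like n^d; if d
  > r, then n <= C * d^d for all n >= d, which is absurd.\<close>

lemma binomial_bounded_by_power:
  assumes C: "\<And>n. n \<ge> 1 \<Longrightarrow> real (n choose d) \<le> C * real n ^ r"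
  shows "d \<le> r"
proof (rule ccontr)
  assume "\<not> d \<le> r"
  then have d: "d \<ge> Suc r" by simp
  obtain n :: nat where n: "real n > C * real d ^ d" "n \<ge> d"
    using reals_Archimedean2[of "max (C * real d ^ d) d"] by auto
  then have n1: "n \<ge> 1" using d by simp
  have "(real n / real d) ^ d \<le> real (n choose d)"
    using binomial_ge_n_over_k_pow_k[OF n(2), where 'a = real] by simp
  also have "\<dots> \<le> C * real n ^ r" using C n1 by blast
  finally have "real n ^ d \<le> C * real d ^ d * real n ^ r"
    using d by (simp add: power_divide divide_simps mult_ac split: if_splits)
  moreover have "real n * real n ^ r \<le> real n ^ d"
    using n1 power_increasing[OF d, of "real n"] by simp
  ultimately have "real n * real n ^ r \<le> (C * real d ^ d) * real n ^ r" by linarith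
  then have "real n \<le> C * real d ^ d"
    using n1 by simp
  with n show False by simp
qed

text \<open>If w = 1 + h with h > 0, a single term of the binomial expansion of w^n already grows
  like n^(r+1).\<close>

lemma power_bounded_by_power:
  fixes w :: real
  assumes C: "\<And>n. n \<ge> 1 \<Longrightarrow> w ^ n \<le> C * real n ^ r"
  shows "w \<le> 1"
proof (rule ccontr)
  assume "\<not> w \<le> 1"
  then have w: "w > 1" by simp
  define h where "h = w - 1"
  have "real (n choose Suc r) \<le> (C / h ^ Suc r) * real n ^ r" if "n \<ge> 1" for n
  proof (cases "Suc r \<le> n")
    case True
    have "real (n choose Suc r) * h ^ Suc r \<le> (\<Sum>k\<le>n. real (n choose k) * h ^ k)"
      by (rule member_le_sum) (use True w in \<open>auto simp: h_def\<close>)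
    also have "\<dots> = w ^ n"
      using binomial_ring[of h 1 n] by (simp add: h_def)
    also have "\<dots> \<le> C * real n ^ r" using C that .
    finally show ?thesis using w by (simp add: h_def field_simps)
  next
    case False
    \<comment> \<open>Here the binomial coefficient is 0, so only the sign of the right-hand side
      matters; n = 1 in the hypothesis gives C >= w.\<close>
    have "0 < C" using C[of 1] w by simp
    then show ?thesis using False w by (simp add: h_def binomial_eq_0)
  qed
  then have "Suc r \<le> r" by (rule binomial_bounded_by_power)
  then show False by simp
qed

subsection \<open>Jordan matrices and coordinates\<close>

lemma jordan_matrix_pow_Cons:
  "jordan_matrix ((k, a) # n_as) ^\<^sub>m n = four_block_mat
    (jordan_block k a ^\<^sub>m n) (0\<^sub>m k (sum_list (map fst n_as)))
    (0\<^sub>m (sum_list (map fst n_as)) k) (jordan_matrix n_as ^\<^sub>m n)"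
proof -
  have dim: "dim_row (diag_block_mat (map (\<lambda>(k, a). jordan_block k a ^\<^sub>m n) n_as)) = sum_list (map fst n_as)"
    "dim_col (diag_block_mat (map (\<lambda>(k, a). jordan_block k a ^\<^sub>m n) n_as)) = sum_list (map fst n_as)"
    using pow_mat_dim[of "jordan_matrix n_as" n]
    unfolding jordan_matrix_pow[symmetric] by auto
  show ?thesis
    unfolding jordan_matrix_pow using dim by (simp add: Let_def)
qed

lemma jordan_matrix_pow_dim [simp]:
  "dim_row (jordan_matrix n_as ^\<^sub>m n) = sum_list (map fst n_as)"
  "dim_col (jordan_matrix n_as ^\<^sub>m n) = sum_list (map fst n_as)"
  by (cases n; simp)+

text \<open>The unimodular factor \<open>a\<close> depends on the row only, so it cancels in products of an entry with
  the conjugate of an entry of the same row.\<close>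

lemma jordan_matrix_pow_row:
  fixes n_as :: "(nat \<times> complex) list"
  assumes "\<And>k a. (k, a) \<in> set n_as \<Longrightarrow> cmod a = 1 \<and> k \<le> Suc r"
    and "i < sum_list (map fst n_as)"
  shows "\<exists>a. cmod a = 1 \<and> (\<forall>j < sum_list (map fst n_as). \<exists>p. degree p \<le> r \<and>
     (\<forall>n. (jordan_matrix n_as ^\<^sub>m n) $$ (i, j) = a ^ n * poly p (of_nat n)))"
  using assms
proof (induction n_as arbitrary: i)
  case Nil
  then show ?case by simp
next
  case (Cons ka n_as)
  obtain k a where ka: "ka = (k, a)" by force
  let ?N = "sum_list (map fst n_as)"
  show ?case
  proof (cases "i < k")
    case True
    have a: "cmod a = 1" "k \<le> Suc r" using Cons.prems(1)[of k a] by (auto simp: ka)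
    have "\<exists>p. degree p \<le> r \<and>
       (\<forall>n. (jordan_matrix (ka # n_as) ^\<^sub>m n) $$ (i, j) = a ^ n * poly p (of_nat n))"
      if j: "j < k + ?N" for j
    proof (cases "j < k \<and> i \<le> j")
      case ij: True
      obtain p :: "complex poly" where p: "degree p \<le> j - i"
        "\<And>n. of_nat (n choose (j - i)) = poly p (of_nat n)"
        using binomial_poly by blast
      have "(jordan_matrix (ka # n_as) ^\<^sub>m n) $$ (i, j)
          = a ^ n * poly (Polynomial.smult (inverse (a ^ (j - i))) p) (of_nat n)" for n
      proof -
        \<comment> \<open>The exponent n + i - j is truncated subtraction. It agrees with n - (j -
          i) once n >= j - i; for smaller n the binomial coefficient makes both sides 0.\<close>
        have "of_nat (n choose (j - i)) * a ^ (n + i - j)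
            = of_nat (n choose (j - i)) * (a ^ n * inverse (a ^ (j - i)))"
        proof (cases "j - i \<le> n")
          case True
          then have "a ^ n = a ^ (n + i - j) * a ^ (j - i)"
            using ij by (simp flip: power_add)
          moreover have "a \<noteq> 0" using a by auto
          ultimately show ?thesis by simp
        qed (simp add: binomial_eq_0)
        then show ?thesis
          using True ij by (simp add: ka jordan_matrix_pow_Cons jordan_block_pow p(2) mult_ac)
      qed
      moreover have "degree (Polynomial.smult (inverse (a ^ (j - i))) p) \<le> r"
        using p(1) a(2) ij by (intro order.trans[OF degree_smult_le]) auto
      ultimately show ?thesis by blast
    next
      case False
      then have "(jordan_matrix (ka # n_as) ^\<^sub>m n) $$ (i, j) = a ^ n * poly 0 (of_nat n)" for n
        using True j by (auto simp: ka jordan_matrix_pow_Cons jordan_block_pow)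
      then show ?thesis by (intro exI[of _ 0]) auto
    qed
    then show ?thesis using a by (auto simp: ka)
  next
    case False
    define i' where "i' = i - k"
    have i': "i = k + i'" "i' < ?N" using False Cons.prems(2) by (auto simp: i'_def ka)
    obtain b where b: "cmod b = 1" "\<And>j. j < ?N \<Longrightarrow> \<exists>p. degree p \<le> r \<and>
     (\<forall>n. (jordan_matrix n_as ^\<^sub>m n) $$ (i', j) = b ^ n * poly p (of_nat n))"
      using Cons.IH[OF _ i'(2)] Cons.prems(1) by auto
    have "\<exists>p. degree p \<le> r \<and>
       (\<forall>n. (jordan_matrix (ka # n_as) ^\<^sub>m n) $$ (i, j) = b ^ n * poly p (of_nat n))"
      if j: "j < k + ?N" for j
    proof (cases "j < k")
      case True
      then have "(jordan_matrix (ka # n_as) ^\<^sub>m n) $$ (i, j) = b ^ n * poly 0 (of_nat n)" for n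
        using i' by (simp add: ka jordan_matrix_pow_Cons)
      then show ?thesis by (intro exI[of _ 0]) auto
    next
      case False
      then have "j - k < ?N" using j by auto
      moreover have "(jordan_matrix (ka # n_as) ^\<^sub>m n) $$ (i, j) = (jordan_matrix n_as ^\<^sub>m n) $$ (i', j - k)" for n
        using False i' j by (simp add: ka jordan_matrix_pow_Cons)
      ultimately show ?thesis using b(2) by presburger
    qed
    then show ?thesis using b(1) by (auto simp: ka)
  qed
qed

text \<open>The position is the upper right corner of the block, shifted by the sizes of the blocks
  before it. It is chosen before n, so one test vector and one coordinate serve all powers.\<close>

lemma jordan_matrix_pow_corner:
  fixes n_as :: "(nat \<times> 'a::comm_ring_1) list"
  assumes "(k, a) \<in> set n_as" "0 < k"
  shows "\<exists>i < sum_list (map fst n_as). \<exists>j < sum_list (map fst n_as).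
    \<forall>n. (jordan_matrix n_as ^\<^sub>m n) $$ (i, j) = of_nat (n choose (k - 1)) * a ^ (n - (k - 1))"
  using assms
proof (induction n_as)
  case Nil
  then show ?case by simp
next
  case (Cons lb n_as)
  obtain l b where lb: "lb = (l, b)" by force
  let ?N = "sum_list (map fst n_as)"
  show ?case
  proof (cases "(k, a) = lb")
    case True
    have "\<forall>n. (jordan_matrix (lb # n_as) ^\<^sub>m n) $$ (0, k - 1)
        = of_nat (n choose (k - 1)) * a ^ (n - (k - 1))"
      using True \<open>0 < k\<close> by (auto simp: lb jordan_matrix_pow_Cons jordan_block_pow)
    then show ?thesis
      using True \<open>0 < k\<close> by (intro exI[of _ 0] conjI exI[of _ "k - 1"]) auto
  next
    case False
    then obtain i j where ij: "i < ?N" "j < ?N"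
      "\<And>n. (jordan_matrix n_as ^\<^sub>m n) $$ (i, j) = of_nat (n choose (k - 1)) * a ^ (n - (k - 1))"
      using Cons by auto
    have "(jordan_matrix (lb # n_as) ^\<^sub>m n) $$ (l + i, l + j) = (jordan_matrix n_as ^\<^sub>m n) $$ (i, j)" for n
      using ij(1,2) by (simp add: lb jordan_matrix_pow_Cons)
    then have "\<forall>n. (jordan_matrix (lb # n_as) ^\<^sub>m n) $$ (l + i, l + j)
        = of_nat (n choose (k - 1)) * a ^ (n - (k - 1))"
      using ij(3) by metis
    then show ?thesis
      using ij by (intro exI[of _ "l + i"] conjI exI[of _ "l + j"]) (auto simp: lb)
  qed
qed

text \<open>The block contributes the factor (X - a)^k to the characteristic polynomial, and 0 < k
  makes \<open>a\<close> a root.\<close>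

lemma jordan_matrix_eigenvector:
  fixes n_as :: "(nat \<times> 'a::field) list"
  assumes "(k, a) \<in> set n_as" "0 < k"
  obtains v where "v \<in> carrier_vec (sum_list (map fst n_as))"
    "v \<noteq> 0\<^sub>v (sum_list (map fst n_as))" "jordan_matrix n_as *\<^sub>v v = a \<cdot>\<^sub>v v"
proof -
  have "poly (char_poly (jordan_matrix n_as)) a = 0"
    using assms by (auto simp: jordan_matrix_char_poly poly_prod_list prod_list_zero_iff image_iff
        intro!: bexI[of _ "(k, a)"])
  then have "eigenvalue (jordan_matrix n_as) a"
    using eigenvalue_root_char_poly jordan_matrix_carrier by blast
  then show ?thesis
    using that unfolding eigenvalue_def eigenvector_def by auto
qed

section \<open>Bases as lists and the coordinates they define\<close>

lemma is_basis_length: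
  assumes "finite_dimensional_vector_space scale Basis" and "is_basis scale bs"
  shows "length bs = card Basis"
proof -
  interpret finite_dimensional_vector_space scale Basis by fact
  have "card (set bs) = dim UNIV"
    using assms(2) unfolding is_basis_def by (intro basis_card_eq_dim) auto
  then show ?thesis
    using assms(2) unfolding is_basis_def by (simp add: distinct_card)
qed

lemma exists_basis_list:
  assumes "finite_dimensional_vector_space scale Basis"
  shows "\<exists>bs. is_basis scale bs"
proof -
  interpret finite_dimensional_vector_space scale Basis by fact
  obtain bs where "set bs = Basis" "distinct bs"
    using finite_distinct_list[OF finite_Basis] by blast
  then show ?thesis
    using independent_Basis span_Basis unfolding is_basis_def by blast
qed

definition coords :: "(complex \<Rightarrow> 'a::ab_group_add \<Rightarrow> 'a) \<Rightarrow> 'a list \<Rightarrow> 'a \<Rightarrow> complex vec" where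
  "coords scale bs x = vec (length bs) (\<lambda>i. module.representation scale (set bs) x (bs ! i))"

lemma basis_expansion:
  assumes "vector_space scale" and bs: "is_basis scale bs"
  shows "(\<Sum>i<length bs. scale (module.representation scale (set bs) x (bs ! i)) (bs ! i)) = x"
proof -
  interpret vector_space scale by fact
  have "(\<Sum>i<length bs. scale (representation (set bs) x (bs ! i)) (bs ! i))
      = (\<Sum>b\<in>set bs. scale (representation (set bs) x b) b)"
    using bs unfolding is_basis_def
    by (intro sum.reindex_bij_betw bij_betw_nth) auto
  also have "\<dots> = x"
    using bs unfolding is_basis_def by (intro sum_representation_eq) auto
  finally show ?thesis .
qed

lemma
  fixes scale :: "complex \<Rightarrow> 'a::ab_group_add \<Rightarrow> 'a"
  assumes vs: "vector_space scale" and bs: "is_basis scale bs"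
  shows coords_add: "coords scale bs (x + y) = coords scale bs x + coords scale bs y"
    and coords_scale: "coords scale bs (scale c x) = c \<cdot>\<^sub>v coords scale bs x"
    and coords_bij: "bij_betw (coords scale bs) UNIV (carrier_vec (length bs))"
    and coords_op: "Vector_Spaces.linear scale scale T \<Longrightarrow>
      coords scale bs (T x) = op_matrix scale bs T *\<^sub>v coords scale bs x"
proof -
  interpret vector_space scale by fact
  have ind: "independent (set bs)" and span: "\<And>x. x \<in> span (set bs)" and dist: "distinct bs"
    using bs unfolding is_basis_def by auto
  show add: "coords scale bs (x + y) = coords scale bs x + coords scale bs y" for x y
    by (rule eq_vecI) (auto simp: coords_def representation_add[OF ind span span])
  show scl: "coords scale bs (scale c x) = c \<cdot>\<^sub>v coords scale bs x" for c x
    by (rule eq_vecI) (auto simp: coords_def representation_scale[OF ind span])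
  have inverse: "(\<Sum>i<length bs. scale (coords scale bs x $ i) (bs ! i)) = x" for x
    using basis_expansion[OF vs bs, of x] by (simp add: coords_def)
  have "coords scale bs (\<Sum>i<length bs. scale (v $ i) (bs ! i)) = v"
    if v: "v \<in> carrier_vec (length bs)" for v
  proof (rule eq_vecI)
    fix j assume "j < dim_vec v"
    then have j: "j < length bs" using v by simp
    have "representation (set bs) (\<Sum>i<length bs. scale (v $ i) (bs ! i)) (bs ! j)
        = (\<Sum>i<length bs. v $ i * representation (set bs) (bs ! i) (bs ! j))"
      using span by (simp add: representation_sum[OF ind] representation_scale[OF ind])
    also have "\<dots> = (\<Sum>i<length bs. if i = j then v $ i else 0)"
      using j dist by (intro sum.cong) (auto simp: representation_basis[OF ind] nth_eq_iff_index_eq)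
    also have "\<dots> = v $ j" using j by simp
    finally show "coords scale bs (\<Sum>i<length bs. scale (v $ i) (bs ! i)) $ j = v $ j"
      using j by (simp add: coords_def)
  qed (use v in \<open>simp add: coords_def\<close>)
  then show "bij_betw (coords scale bs) UNIV (carrier_vec (length bs))"
    using inverse by (intro bij_betw_byWitness[where f' = "\<lambda>v. \<Sum>i<length bs. scale (v $ i) (bs ! i)"])
      (auto simp: coords_def)
  assume T: "Vector_Spaces.linear scale scale T"
  then interpret T: Vector_Spaces.linear scale scale T .
  show "coords scale bs (T x) = op_matrix scale bs T *\<^sub>v coords scale bs x"
  proof (rule eq_vecI)
    fix j assume "j < dim_vec (op_matrix scale bs T *\<^sub>v coords scale bs x)"
    then have j: "j < length bs" by (simp add: op_matrix_def)
    have "representation (set bs) (T x) (bs ! j)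
       = representation (set bs) (T (\<Sum>i<length bs. scale (coords scale bs x $ i) (bs ! i))) (bs ! j)"
      by (simp add: inverse)
    also have "\<dots> = (\<Sum>i<length bs. coords scale bs x $ i * representation (set bs) (T (bs ! i)) (bs ! j))"
      using span by (simp add: T.sum T.scale representation_sum[OF ind] representation_scale[OF ind])
    finally show "coords scale bs (T x) $ j = (op_matrix scale bs T *\<^sub>v coords scale bs x) $ j"
      using j by (simp add: coords_def op_matrix_def scalar_prod_def mult.commute atLeast0LessThan)
  qed (simp add: coords_def op_matrix_def)
qed

text \<open>If A = P J Q with Q P = 1, then Q A = J Q. Hence the old coordinates followed by Q are
  coordinates in a Jordan basis, obtained without naming its vectors. The conclusion on
  \<open>N\<close> ties the block sizes to the dimension.\<close>

lemma jordan_coordinates: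
  fixes scale :: "complex \<Rightarrow> 'a::ab_group_add \<Rightarrow> 'a"
  assumes vs: "vector_space scale" and bs: "is_basis scale bs"
    and T: "Vector_Spaces.linear scale scale T"
    and jnf: "jordan_nf (op_matrix scale bs T) n_as"
  defines "N \<equiv> sum_list (map fst n_as)"
  obtains \<xi> where "bij_betw \<xi> UNIV (carrier_vec N)"
    "\<And>x y. \<xi> (x + y) = \<xi> x + \<xi> y" "\<And>c x. \<xi> (scale c x) = c \<cdot>\<^sub>v \<xi> x"
    "\<And>x n. \<xi> ((T ^^ n) x) = (jordan_matrix n_as ^\<^sub>m n) *\<^sub>v \<xi> x"
    "\<xi> 0 = 0\<^sub>v N" "N = length bs"
proof -
  interpret vector_space scale by (fact vs)
  let ?A = "op_matrix scale bs T" and ?J = "jordan_matrix n_as"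
  have A: "?A \<in> carrier_mat (length bs) (length bs)"
    by (simp add: op_matrix_def)
  obtain P Q where "similar_mat_wit ?A ?J P Q"
    using jnf unfolding jordan_nf_def similar_mat_def by blast
  note wit = similar_mat_witD2[OF A this]
  have N: "N = length bs"
    using wit(5) unfolding N_def by auto
  note carr = wit(4-7)[folded N]
  define \<xi> where "\<xi> x = Q *\<^sub>v coords scale bs x" for x
  have c: "coords scale bs x \<in> carrier_vec N" for x
    by (simp add: coords_def N)
  have "bij_betw (\<lambda>v. Q *\<^sub>v v) (carrier_vec N) (carrier_vec N)"
    using carr wit(1,2)[folded N]
    by (intro bij_betw_byWitness[where f' = "\<lambda>v. P *\<^sub>v v"])
      (auto simp flip: assoc_mult_mat_vec[of _ N N _ N])
  then have bij: "bij_betw \<xi> UNIV (carrier_vec N)"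
    using bij_betw_trans[OF coords_bij[OF vs bs, folded N]] by (simp add: \<xi>_def[abs_def] comp_def)
  have add: "\<xi> (x + y) = \<xi> x + \<xi> y" for x y
    using carr c by (simp add: \<xi>_def coords_add[OF vs bs] mult_add_distrib_mat_vec[of _ N N])
  have scl: "\<xi> (scale d x) = d \<cdot>\<^sub>v \<xi> x" for d x
    using carr c by (simp add: \<xi>_def coords_scale[OF vs bs] mult_mat_vec[of _ N N])
  have step: "\<xi> (T x) = ?J *\<^sub>v \<xi> x" for x
  proof -
    have "\<xi> (T x) = Q *\<^sub>v (P * ?J * Q *\<^sub>v coords scale bs x)"
      by (simp add: \<xi>_def coords_op[OF vs bs T] flip: wit(3))
    also have "\<dots> = Q * P *\<^sub>v (?J *\<^sub>v (Q *\<^sub>v coords scale bs x))"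
      using carr c[of x] by (simp add: assoc_mult_mat_vec[of _ N N _ N])
    also have "\<dots> = ?J *\<^sub>v \<xi> x"
      using carr c[of x] wit(2)[folded N] by (simp add: \<xi>_def)
    finally show ?thesis .
  qed
  have \<xi>: "\<xi> x \<in> carrier_vec N" for x
    using bij by (auto simp: bij_betw_def)
  have "\<xi> ((T ^^ n) x) = (?J ^\<^sub>m n) *\<^sub>v \<xi> x" for n x
  proof (induction n arbitrary: x)
    case 0
    show ?case using \<xi>[of x] by (simp flip: N_def)
  next
    case (Suc n)
    have "\<xi> ((T ^^ Suc n) x) = ?J ^\<^sub>m n *\<^sub>v (?J *\<^sub>v \<xi> x)"
      using Suc[of "T x"] by (simp add: funpow_swap1 step)
    then show ?case
      using carr \<xi>[of x] by (simp add: assoc_mult_mat_vec[of _ N N _ N])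
  qed
  moreover have "\<xi> 0 = 0\<^sub>v N"
  proof -
    have "0 \<cdot>\<^sub>v \<xi> 0 = 0\<^sub>v N"
      using carrier_vecD[OF \<xi>[of 0]] by (intro eq_vecI) auto
    then show ?thesis using scl[of 0 0] by simp
  qed
  ultimately show ?thesis using that bij add scl N by blast
qed

subsection \<open>Finite-dimensional inner product spaces\<close>

context complex_inner_product
begin

lemma ip_zero_left [simp]: "ip 0 y = 0"
  using ip_scale_left[of 0 0 y] by simp

lemma ip_add_right: "ip x (y + z) = ip x y + ip x z"
  by (metis ip_add_left ip_commute complex_cnj_add)

lemma ip_scale_right: "ip x (scale c y) = cnj c * ip x y"
  by (metis ip_scale_left ip_commute complex_cnj_mult)

lemma ip_zero_right [simp]: "ip x 0 = 0"
  using ip_scale_right[of x 0 0] by simp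

lemma ip_diff_left: "ip (x - y) z = ip x z - ip y z"
  by (metis ip_add_left add_diff_cancel_right' diff_add_cancel)

lemma ip_diff_right: "ip x (y - z) = ip x y - ip x z"
  by (metis ip_add_right add_diff_cancel_right' diff_add_cancel)

lemma ip_sum_left: "ip (sum f A) y = (\<Sum>i\<in>A. ip (f i) y)"
  by (induction A rule: infinite_finite_induct) (auto simp: ip_add_left)

lemma ip_sum_right: "ip x (sum f A) = (\<Sum>i\<in>A. ip x (f i))"
  by (induction A rule: infinite_finite_induct) (auto simp: ip_add_right)

lemma Re_ip_nonneg: "0 \<le> Re (ip x x)"
  using ip_pos[of x] by (cases "x = 0") auto

lemma ip_norm_sq: "(ip_norm ip x)\<^sup>2 = Re (ip x x)"
  by (simp add: ip_norm_def Re_ip_nonneg)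

lemma ip_self: "ip x x = of_real ((ip_norm ip x)\<^sup>2)"
  using ip_commute[of x x] by (simp add: ip_norm_sq complex_eq_iff)

lemma ip_norm_nonneg: "0 \<le> ip_norm ip x"
  by (simp add: ip_norm_def Re_ip_nonneg)

lemma ip_norm_pos: "x \<noteq> 0 \<Longrightarrow> 0 < ip_norm ip x"
  by (simp add: ip_norm_def ip_pos)

lemma ip_norm_zero [simp]: "ip_norm ip 0 = 0"
  by (simp add: ip_norm_def)

lemma ip_norm_scale_sq: "(ip_norm ip (scale c x))\<^sup>2 = (cmod c)\<^sup>2 * (ip_norm ip x)\<^sup>2"
proof -
  have "ip (scale c x) (scale c x) = c * cnj c * ip x x"
    by (simp add: ip_scale_left ip_scale_right)
  then show ?thesis
    by (simp add: ip_norm_sq flip: complex_norm_square)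
qed

lemma ip_norm_scale: "ip_norm ip (scale c x) = cmod c * ip_norm ip x"
  by (rule power2_eq_imp_eq) (auto simp: ip_norm_scale_sq power_mult_distrib ip_norm_nonneg)

lemma eq_zero_if_ip_eq_zero: "(\<And>y. ip x y = 0) \<Longrightarrow> x = 0"
  using ip_pos[of x] by fastforce

text \<open>Expanding 0 <= |x - y|^2 bounds the cross term. This serves as a triangle inequality for
  squared norms.\<close>

lemma ip_norm_add_sq_le: "(ip_norm ip (x + y))\<^sup>2 \<le> 2 * (ip_norm ip x)\<^sup>2 + 2 * (ip_norm ip y)\<^sup>2"
  using Re_ip_nonneg[of "x - y"]
  by (simp add: ip_norm_sq ip_add_left ip_add_right ip_diff_left ip_diff_right)

text \<open>One factor 2 is spent per summand. The constant is crude, but only its independence of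
  \<open>f\<close> matters.\<close>

lemma ip_norm_sum_sq_le:
  assumes "finite A"
  shows "(ip_norm ip (sum f A))\<^sup>2 \<le> 2 ^ card A * (\<Sum>i\<in>A. (ip_norm ip (f i))\<^sup>2)"
  using assms
proof induction
  case (insert a A)
  have "(ip_norm ip (sum f (insert a A)))\<^sup>2 \<le> 2 * (ip_norm ip (f a))\<^sup>2 + 2 * (ip_norm ip (sum f A))\<^sup>2"
    using insert ip_norm_add_sq_le by simp
  also have "\<dots> \<le> 2 ^ Suc (card A) * (ip_norm ip (f a))\<^sup>2
      + 2 * (2 ^ card A * (\<Sum>i\<in>A. (ip_norm ip (f i))\<^sup>2))"
    using insert by (intro add_mono mult_right_mono) auto
  finally show ?case
    using insert by (simp add: algebra_simps)
qed simp

definition orthonormal :: "'a set \<Rightarrow> bool" where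
  "orthonormal E \<longleftrightarrow> finite E \<and> (\<forall>u\<in>E. \<forall>v\<in>E. ip u v = of_bool (u = v))"

lemma orthonormal_ip_sum:
  assumes "orthonormal E" "v \<in> E"
  shows "ip (\<Sum>u\<in>E. scale (c u) u) v = c v"
proof -
  have "ip (\<Sum>u\<in>E. scale (c u) u) v = (\<Sum>u\<in>E. if u = v then c u else 0)"
    unfolding ip_sum_left ip_scale_left
    using assms by (intro sum.cong) (auto simp: orthonormal_def)
  also have "\<dots> = c v"
    using assms by (simp add: orthonormal_def)
  finally show ?thesis .
qed

end

section \<open>Orthonormal bases, boundedness and adjoints in finite dimension\<close>

locale finite_dim_inner_product =
  finite_dimensional_vector_space scale Basis + complex_inner_product scale ip
  for scale :: "complex \<Rightarrow> 'a::ab_group_add \<Rightarrow> 'a" and Basis ip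
begin

lemma other_inner_product:
  assumes "complex_inner_product scale ip'"
  shows "finite_dim_inner_product scale Basis ip'"
  using assms by (simp add: finite_dim_inner_product_def finite_dimensional_vector_space_axioms)

lemma orthonormal_independent:
  assumes "orthonormal E"
  shows "independent E"
  unfolding independent_explicit
proof (intro conjI allI impI ballI)
  show "finite E" using assms by (simp add: orthonormal_def)
  fix c v assume "(\<Sum>v\<in>E. scale (c v) v) = 0" "v \<in> E"
  then show "c v = 0" using orthonormal_ip_sum[OF assms, of v c] by simp
qed

text \<open>Orthonormal sets are independent, so their sizes are bounded by the dimension and a
  largest one exists. If some vector were not recovered from its coefficients, its normalised
  residual could be added to that set.\<close>

lemma orthonormal_basis:
  obtains E where "orthonormal E" "card E = card Basis"
    "\<And>x. (\<Sum>v\<in>E. scale (ip x v) v) = x"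
proof -
  have bound: "card E \<le> card Basis" if "orthonormal E" for E
    using independent_card_le_dim[OF subset_UNIV orthonormal_independent[OF that]] by simp
  have "orthonormal {}" by (simp add: orthonormal_def)
  from ex_has_greatest_nat[of orthonormal "{}" card "Suc (card Basis)", OF this]
  obtain E where E: "orthonormal E" and max: "\<And>F. orthonormal F \<Longrightarrow> card F \<le> card E"
    using bound by (auto simp: less_Suc_eq_le)
  have fin: "finite E" using E by (simp add: orthonormal_def)
  have expand: "(\<Sum>v\<in>E. scale (ip x v) v) = x" for x
  proof (rule ccontr)
    assume ne: "(\<Sum>v\<in>E. scale (ip x v) v) \<noteq> x"
    define w where "w = x - (\<Sum>v\<in>E. scale (ip x v) v)"
    define u where "u = scale (of_real (inverse (ip_norm ip w))) w"
    have w: "ip_norm ip w > 0" using ne by (intro ip_norm_pos) (simp add: w_def)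
    have wE: "ip w v = 0" if "v \<in> E" for v
      using orthonormal_ip_sum[OF E that, of "\<lambda>v. ip x v"] by (simp add: w_def ip_diff_left)
    have uu: "ip u u = 1"
      using w by (simp add: ip_self u_def ip_norm_scale norm_inverse)
    have uE: "ip u v = 0" "ip v u = 0" if "v \<in> E" for v
      using wE[OF that] ip_commute[of v u] by (simp_all add: u_def ip_scale_left)
    then have "u \<notin> E" using uu by force
    moreover have "orthonormal (insert u E)"
      using E uu uE unfolding orthonormal_def by auto
    then have "card (insert u E) \<le> card E" by (rule max)
    ultimately show False using fin by simp
  qed
  have "x \<in> span E" for x
    using span_sum[of E "\<lambda>v. scale (ip x v) v" E] by (simp add: expand span_base span_scale)
  then have "card E = dim UNIV"
    using orthonormal_independent[OF E] by (intro basis_card_eq_dim) auto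
  then show ?thesis using that E expand by simp
qed

text \<open>One term of Parseval's identity, which comes from expanding the first argument of
  \<open>ip x x\<close>.\<close>

lemma bessel:
  assumes "orthonormal E" "\<And>x. (\<Sum>v\<in>E. scale (ip x v) v) = x" "v \<in> E"
  shows "(cmod (ip x v))\<^sup>2 \<le> (ip_norm ip x)\<^sup>2"
proof -
  have "ip x x = (\<Sum>v\<in>E. ip x v * ip v x)"
    using ip_sum_left[of "\<lambda>v. scale (ip x v) v" E x] by (simp add: assms(2) ip_scale_left)
  also have "\<dots> = of_real (\<Sum>v\<in>E. (cmod (ip x v))\<^sup>2)"
    unfolding of_real_sum by (intro sum.cong refl) (simp only: complex_norm_square ip_commute[of _ x])
  finally have "(ip_norm ip x)\<^sup>2 = (\<Sum>v\<in>E. (cmod (ip x v))\<^sup>2)"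
    by (simp only: ip_self of_real_eq_iff)
  then show ?thesis
    using assms by (auto simp: orthonormal_def intro!: member_le_sum)
qed

text \<open>\<open>T\<close> is determined by its values on an orthonormal basis, and the
  coefficients of x are bounded by its norm. Source and target carry different inner products so
  that the identity map yields the comparison of two norms.\<close>

lemma linear_bounded:
  assumes "complex_inner_product scale ip'" and "Vector_Spaces.linear scale scale T"
  obtains C where "C > 0" "\<And>x. (ip_norm ip' (T x))\<^sup>2 \<le> C * (ip_norm ip x)\<^sup>2"
proof -
  interpret ip': complex_inner_product scale ip' by fact
  interpret T: Vector_Spaces.linear scale scale T by fact
  obtain E where E: "orthonormal E" "\<And>x. (\<Sum>v\<in>E. scale (ip x v) v) = x"
    using orthonormal_basis by metis
  have fin: "finite E" using E by (simp add: orthonormal_def)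
  \<comment> \<open>The summand 1 keeps the constant positive when \<open>T\<close> is zero.\<close>
  define C where "C = 2 ^ card E * (\<Sum>v\<in>E. (ip_norm ip' (T v))\<^sup>2) + 1"
  have "(ip_norm ip' (T x))\<^sup>2 \<le> C * (ip_norm ip x)\<^sup>2" for x
  proof -
    have "T x = (\<Sum>v\<in>E. scale (ip x v) (T v))"
      using T.sum[of "\<lambda>v. scale (ip x v) v" E] by (simp add: E(2) T.scale)
    then have "(ip_norm ip' (T x))\<^sup>2 \<le> 2 ^ card E * (\<Sum>v\<in>E. (cmod (ip x v))\<^sup>2 * (ip_norm ip' (T v))\<^sup>2)"
      using ip'.ip_norm_sum_sq_le[OF fin, of "\<lambda>v. scale (ip x v) (T v)"]
      by (simp add: ip'.ip_norm_scale_sq)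
    also have "\<dots> \<le> 2 ^ card E * (\<Sum>v\<in>E. (ip_norm ip x)\<^sup>2 * (ip_norm ip' (T v))\<^sup>2)"
      by (intro mult_left_mono sum_mono mult_right_mono bessel[OF E]) auto
    also have "\<dots> \<le> C * (ip_norm ip x)\<^sup>2"
      by (simp add: C_def algebra_simps flip: sum_distrib_left)
    finally show ?thesis .
  qed
  moreover have "C > 0"
    unfolding C_def by (intro add_nonneg_pos mult_nonneg_nonneg sum_nonneg) auto
  ultimately show ?thesis using that by blast
qed

text \<open>Complex-valued analogue of \<open>linear_bounded\<close>; it later bounds a single
  Jordan coordinate by the norm.\<close>

lemma functional_bounded:
  assumes add: "\<And>x y. f (x + y) = f x + f y" and scl: "\<And>c x. f (scale c x) = c * f x"
  obtains C where "C > 0" "\<And>x. cmod (f x) \<le> C * ip_norm ip x"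
proof -
  obtain E where E: "orthonormal E" "\<And>x. (\<Sum>v\<in>E. scale (ip x v) v) = x"
    using orthonormal_basis by metis
  have sum: "f (sum g A) = (\<Sum>i\<in>A. f (g i))" if "finite A" for g :: "'a \<Rightarrow> 'a" and A
    using that by induction (use scl[of 0 0] in \<open>auto simp: add\<close>)
  have "cmod (f x) \<le> (1 + (\<Sum>v\<in>E. cmod (f v))) * ip_norm ip x" for x
  proof -
    have "f x = (\<Sum>v\<in>E. ip x v * f v)"
      using sum[of E "\<lambda>v. scale (ip x v) v"] E by (simp add: orthonormal_def scl)
    then have "cmod (f x) \<le> (\<Sum>v\<in>E. ip_norm ip x * cmod (f v))"
      by (auto simp: norm_mult ip_norm_nonneg intro!: sum_norm_le mult_right_mono
          power2_le_imp_le[OF bessel[OF E]])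
    also have "\<dots> \<le> (1 + (\<Sum>v\<in>E. cmod (f v))) * ip_norm ip x"
      using ip_norm_nonneg[of x] by (simp add: algebra_simps flip: sum_distrib_left)
    finally show ?thesis .
  qed
  then show ?thesis
    by (intro that[of "1 + (\<Sum>v\<in>E. cmod (f v))"]) (auto intro!: add_pos_nonneg sum_nonneg)
qed

text \<open>\<open>hadjoint\<close> is a definite description, so existence and uniqueness both have
  to be supplied. The witness \<open>S\<close> is forced: the coefficient of the adjoint image of y
  along v must be \<open>ip y (T v)\<close>. Uniqueness is nondegeneracy.\<close>

lemma hadjoint_ip:
  assumes "Vector_Spaces.linear scale scale T"
  shows "ip (T x) y = ip x (hadjoint ip T y)"
proof -
  interpret T: Vector_Spaces.linear scale scale T by fact
  obtain E where E: "orthonormal E" "\<And>x. (\<Sum>v\<in>E. scale (ip x v) v) = x"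
    using orthonormal_basis by metis
  define S where "S y = (\<Sum>v\<in>E. scale (ip y (T v)) v)" for y
  have S: "\<forall>x y. ip (T x) y = ip x (S y)"
  proof (intro allI)
    fix x y
    have "ip (T x) y = (\<Sum>v\<in>E. ip x v * ip (T v) y)"
      using arg_cong[OF T.sum[of "\<lambda>v. scale (ip x v) v" E], of "\<lambda>z. ip z y"]
      by (simp add: E(2) T.scale ip_sum_left ip_scale_left)
    also have "\<dots> = ip x (S y)"
      by (simp add: S_def ip_sum_right ip_scale_right ip_commute[of _ y, symmetric] mult.commute)
    finally show "ip (T x) y = ip x (S y)" .
  qed
  have "\<forall>x y. ip (T x) y = ip x (hadjoint ip T y)"
    unfolding hadjoint_def
  proof (rule theI[of _ S])
    show "\<forall>x y. ip (T x) y = ip x (S y)" by (fact S)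
    fix S' assume S': "\<forall>x y. ip (T x) y = ip x (S' y)"
    have "ip (S' y - S y) z = 0" for y z
    proof -
      have "ip z (S' y - S y) = 0" using S S' by (simp add: ip_diff_right)
      then show ?thesis using ip_commute[of "S' y - S y" z] by simp
    qed
    then have "S' y - S y = 0" for y by (rule eq_zero_if_ip_eq_zero)
    then show "S' = S" by auto
  qed
  then show ?thesis by blast
qed

text \<open>Powers of the adjoint are moved across \<open>ip\<close>, and a vector is zero iff it is
  orthogonal to every y. Keeping two arguments x and y translates the operator identity directly,
  without polarisation.\<close>

lemma m_isometry_iff_fdiff:
  assumes T: "Vector_Spaces.linear scale scale T"
  shows "m_isometry scale ip m T \<longleftrightarrow>
    (\<forall>x y. (fdiff ^^ m) (\<lambda>n. ip ((T ^^ n) x) ((T ^^ n) y)) 0 = 0)"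
proof -
  have adj: "ip ((hadjoint ip T ^^ k) u) y = ip u ((T ^^ k) y)" for k u y
  proof (induction k arbitrary: y)
    case (Suc k)
    have "ip (hadjoint ip T w) y = ip w (T y)" for w
      using hadjoint_ip[OF T, of y w] by (metis ip_commute)
    then show ?case using Suc[of "T y"] by (simp add: funpow_swap1[of T])
  qed simp
  have "ip (beta_op scale ip m T x) y = (fdiff ^^ m) (\<lambda>n. ip ((T ^^ n) x) ((T ^^ n) y)) 0" for x y
    by (simp add: beta_op_def ip_sum_left ip_scale_left adj fdiff_funpow)
  then show ?thesis
    unfolding m_isometry_def using T eq_zero_if_ip_eq_zero by (metis ip_zero_left)
qed

text \<open>Together the two facts make the squared operator norm the least constant in a squared
  vector-wise bound, so growth conditions can be restated vector by vector.\<close>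

lemma
  assumes T: "Vector_Spaces.linear scale scale T"
  shows ip_norm_le_op_norm: "(ip_norm ip (T x))\<^sup>2 \<le> (op_norm ip T)\<^sup>2 * (ip_norm ip x)\<^sup>2"
    and op_norm_sq_le: "(\<And>x. (ip_norm ip (T x))\<^sup>2 \<le> K * (ip_norm ip x)\<^sup>2) \<Longrightarrow> 0 \<le> K \<Longrightarrow> (op_norm ip T)\<^sup>2 \<le> K"
proof -
  interpret T: Vector_Spaces.linear scale scale T by fact
  have le_sqrt: "ip_norm ip (T x) \<le> sqrt K"
    if "\<And>x. (ip_norm ip (T x))\<^sup>2 \<le> K * (ip_norm ip x)\<^sup>2" "0 \<le> K" "ip_norm ip x \<le> 1" for K x
  proof (rule real_le_rsqrt)
    have "(ip_norm ip x)\<^sup>2 \<le> 1" using that(3) ip_norm_nonneg[of x] by (simp add: power_le_one)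
    then show "(ip_norm ip (T x))\<^sup>2 \<le> K"
      using that(1)[of x] mult_left_mono[of "(ip_norm ip x)\<^sup>2" 1 K] that(2) by simp
  qed
  obtain C where C: "C > 0" "\<And>x. (ip_norm ip (T x))\<^sup>2 \<le> C * (ip_norm ip x)\<^sup>2"
    using linear_bounded[OF complex_inner_product_axioms T] by blast
  \<comment> \<open>A real supremum has its usual meaning only for a set that is bounded
    above.\<close>
  have bdd: "bdd_above {ip_norm ip (T x) | x. ip_norm ip x \<le> 1}"
    using le_sqrt[OF C(2)] C(1) by (intro bdd_aboveI[of _ "sqrt C"]) auto
  have upper: "ip_norm ip (T x) \<le> op_norm ip T" if "ip_norm ip x \<le> 1" for x
    unfolding op_norm_def by (rule cSup_upper[OF _ bdd]) (use that in auto)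
  have nonneg: "0 \<le> op_norm ip T"
    using upper[of 0] by (simp add: T.zero)
  show "(ip_norm ip (T x))\<^sup>2 \<le> (op_norm ip T)\<^sup>2 * (ip_norm ip x)\<^sup>2"
  proof (cases "x = 0")
    case False
    then have pos: "ip_norm ip x > 0" by (rule ip_norm_pos)
    define u where "u = scale (of_real (inverse (ip_norm ip x))) x"
    have "ip_norm ip (T u) \<le> op_norm ip T"
      by (rule upper) (use pos in \<open>simp add: u_def ip_norm_scale norm_inverse\<close>)
    moreover have "ip_norm ip (T u) = ip_norm ip (T x) / ip_norm ip x"
      using pos by (simp add: u_def T.scale ip_norm_scale norm_inverse divide_inverse mult.commute)
    ultimately have "ip_norm ip (T x) \<le> op_norm ip T * ip_norm ip x"
      using pos by (simp add: divide_simps)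
    then show ?thesis
      using ip_norm_nonneg by (metis power_mono power_mult_distrib)
  qed (simp add: T.zero)
  assume "\<And>x. (ip_norm ip (T x))\<^sup>2 \<le> K * (ip_norm ip x)\<^sup>2" "0 \<le> K"
  note K = le_sqrt[OF this]
  have "op_norm ip T \<le> sqrt K"
    unfolding op_norm_def
    by (rule cSup_least) (use K in \<open>auto intro: exI[of _ 0]\<close>)
  then have "(op_norm ip T)\<^sup>2 \<le> (sqrt K)\<^sup>2"
    using nonneg by (intro power_mono)
  then show "(op_norm ip T)\<^sup>2 \<le> K"
    using \<open>0 \<le> K\<close> by simp
qed

end

subsection \<open>Growth of powers\<close>

lemma invertible_op_iff_bij:
  assumes "vector_space scale"
  shows "invertible_op scale T \<longleftrightarrow> Vector_Spaces.linear scale scale T \<and> bij T"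
proof
  assume "invertible_op scale T"
  then show "Vector_Spaces.linear scale scale T \<and> bij T"
    unfolding invertible_op_def by (metis o_bij)
next
  assume T: "Vector_Spaces.linear scale scale T \<and> bij T"
  have "Vector_Spaces.linear scale scale (inv_into UNIV T)"
  proof -
    have "inv_into UNIV T (x + y) = inv_into UNIV T x + inv_into UNIV T y" for x y
      using T unfolding Vector_Spaces.linear_iff by (metis bij_inv_eq_iff)
    moreover have "inv_into UNIV T (scale c x) = scale c (inv_into UNIV T x)" for c x
      using T unfolding Vector_Spaces.linear_iff by (metis bij_inv_eq_iff)
    ultimately show ?thesis
      using assms by (simp add: Vector_Spaces.linear_iff)
  qed
  moreover have "inv_into UNIV T \<circ> T = id" "T \<circ> inv_into UNIV T = id"
    using T by (auto simp: fun_eq_iff bij_is_inj bij_is_surj surj_f_inv_f)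
  ultimately show "invertible_op scale T"
    using T unfolding invertible_op_def by blast
qed

lemma invertible_op_inv:
  assumes "vector_space scale" "invertible_op scale T"
  shows "invertible_op scale (inv_into UNIV T)"
proof -
  obtain S where S: "Vector_Spaces.linear scale scale S" "S \<circ> T = id" "T \<circ> S = id"
    using assms(2) unfolding invertible_op_def by blast
  then have "inv_into UNIV T = S" by (metis inv_unique_comp)
  then show ?thesis
    using S assms(2) unfolding invertible_op_def by blast
qed

context vector_space
begin

lemma linear_funpow:
  assumes "Vector_Spaces.linear scale scale T"
  shows "Vector_Spaces.linear scale scale (T ^^ n)"
proof (induction n)
  case 0
  show ?case using linear_id by (simp add: id_def)
next
  case (Suc n)
  show ?case unfolding funpow.simps by (rule Vector_Spaces.linear_compose[OF Suc assms])
qed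

end

lemma (in finite_dimensional_vector_space) bij_if_trivial_kernel:
  assumes "Vector_Spaces.linear scale scale T" "\<And>x. T x = 0 \<Longrightarrow> x = 0"
  shows "bij T"
proof -
  interpret T: Vector_Spaces.linear scale scale T by fact
  have "inj T" using assms(2) T.inj_iff_eq_0 by blast
  then show ?thesis
    using linear_inj_imp_surj[OF assms(1)] by (simp add: bij_def)
qed

text \<open>The growth condition (c) with exponent p, freed of supremum, operator norm and integer
  powers: \<open>T\<close> and its inverse with exponents n >= 1 stand for the nonzero integers, and
  one constant serves both.\<close>

definition power_growth ::
  "(complex \<Rightarrow> 'a::ab_group_add \<Rightarrow> 'a) \<Rightarrow> ('a \<Rightarrow> 'a \<Rightarrow> complex) \<Rightarrow> nat \<Rightarrow> ('a \<Rightarrow> 'a) \<Rightarrow> bool" where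
  "power_growth scale ip p T \<longleftrightarrow> invertible_op scale T \<and> (\<exists>K\<ge>0. \<forall>S\<in>{T, inv_into UNIV T}. \<forall>n\<ge>1. \<forall>x.
    (ip_norm ip ((S ^^ n) x))\<^sup>2 \<le> K * real n ^ p * (ip_norm ip x)\<^sup>2)"

context finite_dim_inner_product
begin

lemma sup_finite_iff_power_growth:
  "invertible_op scale T \<and> (SUP n\<in>UNIV - {0::int}.
      ereal ((op_norm ip (op_powi T n))\<^sup>2 / real_of_int \<bar>n\<bar> ^ p)) < \<infinity>
    \<longleftrightarrow> power_growth scale ip p T"
proof (cases "invertible_op scale T")
  case True
  have lin: "Vector_Spaces.linear scale scale T" "Vector_Spaces.linear scale scale (inv_into UNIV T)"
    using True invertible_op_inv[OF vector_space_axioms True] by (auto simp: invertible_op_def)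
  then have lin_pow: "Vector_Spaces.linear scale scale (S ^^ n)" if "S \<in> {T, inv_into UNIV T}" for S n
    using that linear_funpow by blast
  let ?q = "\<lambda>n. (op_norm ip (op_powi T n))\<^sup>2 / real_of_int \<bar>n\<bar> ^ p"
  have "(SUP n\<in>UNIV - {0::int}. ereal (?q n)) < \<infinity> \<longleftrightarrow> (\<exists>K\<ge>0. \<forall>n. n \<noteq> 0 \<longrightarrow> ?q n \<le> K)"
  proof
    assume "(SUP n\<in>UNIV - {0::int}. ereal (?q n)) < \<infinity>"
    then obtain k :: nat where k: "(SUP n\<in>UNIV - {0::int}. ereal (?q n)) < ereal (real k)"
      using less_PInf_Ex_of_nat by (auto simp: less_top)
    have "?q n \<le> real k" if "n \<noteq> 0" for n
    proof -
      have "ereal (?q n) \<le> (SUP n\<in>UNIV - {0::int}. ereal (?q n))"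
        using that by (intro SUP_upper) auto
      also note k
      finally show ?thesis by simp
    qed
    then show "\<exists>K\<ge>0. \<forall>n. n \<noteq> 0 \<longrightarrow> ?q n \<le> K" by (intro exI[of _ "real k"]) auto
  next
    assume "\<exists>K\<ge>0. \<forall>n. n \<noteq> 0 \<longrightarrow> ?q n \<le> K"
    then obtain K where "\<And>n. n \<noteq> 0 \<Longrightarrow> ?q n \<le> K" by blast
    then have "(SUP n\<in>UNIV - {0::int}. ereal (?q n)) \<le> ereal K"
      by (intro SUP_least) auto
    then show "(SUP n\<in>UNIV - {0::int}. ereal (?q n)) < \<infinity>"
      by (rule le_less_trans) simp
  qed
  also have "\<dots> \<longleftrightarrow> (\<exists>K\<ge>0. \<forall>S\<in>{T, inv_into UNIV T}. \<forall>n\<ge>1. (op_norm ip (S ^^ n))\<^sup>2 \<le> K * real n ^ p)"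
  proof -
    have "(\<forall>n. n \<noteq> 0 \<longrightarrow> ?q n \<le> K) \<longleftrightarrow>
        (\<forall>S\<in>{T, inv_into UNIV T}. \<forall>n\<ge>1. (op_norm ip (S ^^ n))\<^sup>2 \<le> K * real n ^ p)" for K
    proof
      assume *: "\<forall>n. n \<noteq> 0 \<longrightarrow> ?q n \<le> K"
      show "\<forall>S\<in>{T, inv_into UNIV T}. \<forall>n\<ge>1. (op_norm ip (S ^^ n))\<^sup>2 \<le> K * real n ^ p"
      proof (intro ballI allI impI)
        fix S and n :: nat assume S: "S \<in> {T, inv_into UNIV T}" and n: "n \<ge> 1"
        \<comment> \<open>If \<open>T\<close> is its own inverse, both signs give the same power;
          otherwise S different from \<open>T\<close> is the inverse and needs the negative
          exponent.\<close>
        define l where "l = (if S = T then int n else - int n)"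
        have "op_powi T l = S ^^ n" "\<bar>l\<bar> = int n" "l \<noteq> 0"
          using S n by (auto simp: l_def op_powi_def)
        then show "(op_norm ip (S ^^ n))\<^sup>2 \<le> K * real n ^ p"
          using *[rule_format, of l] n by (simp add: divide_simps split: if_splits)
      qed
    next
      assume *: "\<forall>S\<in>{T, inv_into UNIV T}. \<forall>n\<ge>1. (op_norm ip (S ^^ n))\<^sup>2 \<le> K * real n ^ p"
      show "\<forall>n. n \<noteq> 0 \<longrightarrow> ?q n \<le> K"
      proof (intro allI impI)
        fix n :: int assume n: "n \<noteq> 0"
        obtain S where S: "S \<in> {T, inv_into UNIV T}" "op_powi T n = S ^^ nat \<bar>n\<bar>"
          by (cases "n \<ge> 0") (auto simp: op_powi_def)
        have "(op_norm ip (S ^^ nat \<bar>n\<bar>))\<^sup>2 \<le> K * real (nat \<bar>n\<bar>) ^ p"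
          using * S(1) n by (metis Suc_leI One_nat_def zero_less_nat_eq zero_less_abs_iff)
        then show "?q n \<le> K"
          using n by (simp add: S(2) divide_simps)
      qed
    qed
    then show ?thesis by simp
  qed
  also have "\<dots> \<longleftrightarrow> (\<exists>K\<ge>0. \<forall>S\<in>{T, inv_into UNIV T}. \<forall>n\<ge>1. \<forall>x.
    (ip_norm ip ((S ^^ n) x))\<^sup>2 \<le> K * real n ^ p * (ip_norm ip x)\<^sup>2)"
  proof -
    have "(op_norm ip (S ^^ n))\<^sup>2 \<le> K * real n ^ p \<longleftrightarrow>
      (\<forall>x. (ip_norm ip ((S ^^ n) x))\<^sup>2 \<le> K * real n ^ p * (ip_norm ip x)\<^sup>2)"
      if "S \<in> {T, inv_into UNIV T}" "0 \<le> K" for S K n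
    proof
      assume "(op_norm ip (S ^^ n))\<^sup>2 \<le> K * real n ^ p"
      then show "\<forall>x. (ip_norm ip ((S ^^ n) x))\<^sup>2 \<le> K * real n ^ p * (ip_norm ip x)\<^sup>2"
        using ip_norm_le_op_norm[OF lin_pow[OF that(1)]]
        by (meson mult_right_mono order_trans zero_le_power2)
    next
      assume "\<forall>x. (ip_norm ip ((S ^^ n) x))\<^sup>2 \<le> K * real n ^ p * (ip_norm ip x)\<^sup>2"
      then show "(op_norm ip (S ^^ n))\<^sup>2 \<le> K * real n ^ p"
        using op_norm_sq_le[OF lin_pow[OF that(1)]] that(2) by simp
    qed
    then show ?thesis by (metis (no_types, lifting))
  qed
  finally show ?thesis
    using True by (simp add: power_growth_def)
qed (simp add: power_growth_def)

text \<open>The hypothesis at the vector S^l x says that the difference of the orbit of x vanishes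
  at l. The first m values of that orbit are bounded by a fixed multiple of the squared norm of x,
  which makes the final constant uniform in x.\<close>

lemma bounded_if_fdiff_funpow_eq_0:
  assumes S: "Vector_Spaces.linear scale scale S"
    and zero: "\<And>x. (fdiff ^^ m) (\<lambda>n. ip ((S ^^ n) x) ((S ^^ n) x)) 0 = 0"
  shows "\<exists>K\<ge>0. \<forall>n\<ge>1. \<forall>x. (ip_norm ip ((S ^^ n) x))\<^sup>2 \<le> K * real n ^ (m - 1) * (ip_norm ip x)\<^sup>2"
proof -
  have "\<exists>C>0. \<forall>x. (ip_norm ip ((S ^^ k) x))\<^sup>2 \<le> C * (ip_norm ip x)\<^sup>2" for k
    using linear_bounded[OF complex_inner_product_axioms linear_funpow[OF S]] by metis
  then obtain C where C: "\<And>k. C k > 0" "\<And>k x. (ip_norm ip ((S ^^ k) x))\<^sup>2 \<le> C k * (ip_norm ip x)\<^sup>2"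
    by metis
  define M where "M = (\<Sum>k<m. C k)"
  have M: "M \<ge> 0" using C(1) by (simp add: M_def sum_nonneg less_imp_le)
  have CM: "C k \<le> M" if "k < m" for k
    unfolding M_def using that C(1) by (intro member_le_sum) (auto simp: less_imp_le)
  have "(ip_norm ip ((S ^^ n) x))\<^sup>2 \<le> (real m * 2 ^ m * M) * real n ^ (m - 1) * (ip_norm ip x)\<^sup>2"
    if n: "n \<ge> 1" for n x
  proof -
    define f where "f k = ip ((S ^^ k) x) ((S ^^ k) x)" for k
    have norm_f: "norm (f k) = (ip_norm ip ((S ^^ k) x))\<^sup>2" for k
      by (simp add: f_def ip_self norm_power)
    have "(fdiff ^^ m) f l = 0" for l
    proof -
      have "(fdiff ^^ m) f l = (fdiff ^^ m) (\<lambda>k. f (l + k)) 0"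
        by (rule fdiff_funpow_shift[symmetric])
      also have "(\<lambda>k. f (l + k)) = (\<lambda>k. ip ((S ^^ k) ((S ^^ l) x)) ((S ^^ k) ((S ^^ l) x)))"
        by (simp add: f_def fun_eq_iff add.commute[of l] funpow_add)
      finally show ?thesis using zero by simp
    qed
    moreover have "norm (f k) \<le> M * (ip_norm ip x)\<^sup>2" if "k < m" for k
      using C(2)[of k x] mult_right_mono[OF CM[OF that], of "(ip_norm ip x)\<^sup>2"]
      by (simp add: norm_f)
    ultimately have "norm (f n) \<le> real m * 2 ^ m * (M * (ip_norm ip x)\<^sup>2) * real n ^ (m - 1)"
      using n M by (intro norm_le_of_fdiff_funpow_eq_0) auto
    then show ?thesis by (simp add: norm_f mult_ac)
  qed
  then show ?thesis
    using M by (intro exI[of _ "real m * 2 ^ m * M"]) auto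
qed

lemma m_isometry_power_growth:
  assumes iso: "m_isometry scale ip m T"
  shows "power_growth scale ip (m - 1) T"
proof -
  have T: "Vector_Spaces.linear scale scale T" using iso by (simp add: m_isometry_def)
  interpret T: Vector_Spaces.linear scale scale T by fact
  have zero: "(fdiff ^^ m) (\<lambda>n. ip ((T ^^ n) x) ((T ^^ n) y)) 0 = 0" for x y
    using m_isometry_iff_fdiff[OF T] iso by blast
  have "x = 0" if "T x = 0" for x
  proof -
    have "(T ^^ k) x = 0" if "k > 0" for k
    proof -
      interpret Tk: Vector_Spaces.linear scale scale "T ^^ (k - 1)" by (rule linear_funpow[OF T])
      have "(T ^^ k) x = (T ^^ (k - 1)) (T x)"
        using that by (metis Suc_diff_1 funpow_Suc_right comp_apply)
      then show ?thesis using \<open>T x = 0\<close> Tk.zero by simp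
    qed
    \<comment> \<open>On a kernel vector only the term k = 0 survives, so the difference equation
      forces x = 0.\<close>
    then have "(fdiff ^^ m) (\<lambda>n. ip ((T ^^ n) x) ((T ^^ n) x)) 0 = (-1) ^ m * ip x x"
      unfolding fdiff_funpow by (subst sum.remove[of _ 0]) (auto intro!: sum.neutral)
    then have "ip x x = 0" using zero by simp
    then show ?thesis using ip_pos[of x] by fastforce
  qed
  then have bij: "bij T" using bij_if_trivial_kernel[OF T] by blast
  then have inv: "invertible_op scale T"
    using T by (simp add: invertible_op_iff_bij[OF vector_space_axioms])
  let ?S = "inv_into UNIV T"
  have S: "Vector_Spaces.linear scale scale ?S"
    using invertible_op_inv[OF vector_space_axioms inv] by (simp add: invertible_op_def)
  have cancel: "(?S ^^ k) ((T ^^ (k + l)) x) = (T ^^ l) x" for k l x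
    using bij by (induction k arbitrary: l) (simp_all add: funpow_swap1[of ?S] bij_is_inj)
  have inv_pow: "(T ^^ k) ((?S ^^ k) x) = x" for k x
    using bij by (induction k arbitrary: x) (simp_all add: funpow_swap1[of T] bij_is_surj surj_f_inv_f)
  have "(fdiff ^^ m) (\<lambda>n. ip ((?S ^^ n) x) ((?S ^^ n) x)) 0 = 0" for x
  proof -
    \<comment> \<open>Seen from the point m steps back, the inverse orbit of x is a forward orbit of
      \<open>T\<close> read backwards.\<close>
    define u where "u = (?S ^^ m) x"
    have "(?S ^^ k) x = (T ^^ (m - k)) u" if "k \<le> m" for k
      using cancel[of k "m - k" u] inv_pow[of m x] that by (simp add: u_def)
    then have "(fdiff ^^ m) (\<lambda>n. ip ((?S ^^ n) x) ((?S ^^ n) x)) 0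
        = (fdiff ^^ m) (\<lambda>n. ip ((T ^^ (m - n)) u) ((T ^^ (m - n)) u)) 0"
      by (intro fdiff_funpow_cong) simp
    also have "\<dots> = (-1) ^ m * (fdiff ^^ m) (\<lambda>n. ip ((T ^^ n) u) ((T ^^ n) u)) 0"
      by (rule fdiff_funpow_reverse)
    finally show ?thesis using zero by simp
  qed
  from bounded_if_fdiff_funpow_eq_0[OF S this] obtain K2 where K2: "K2 \<ge> 0"
    "\<And>n x. n \<ge> 1 \<Longrightarrow> (ip_norm ip ((?S ^^ n) x))\<^sup>2 \<le> K2 * real n ^ (m - 1) * (ip_norm ip x)\<^sup>2"
    by blast
  from bounded_if_fdiff_funpow_eq_0[OF T zero] obtain K1 where K1: "K1 \<ge> 0"
    "\<And>n x. n \<ge> 1 \<Longrightarrow> (ip_norm ip ((T ^^ n) x))\<^sup>2 \<le> K1 * real n ^ (m - 1) * (ip_norm ip x)\<^sup>2"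
    by blast
  have mono: "K * real n ^ (m - 1) * (ip_norm ip x)\<^sup>2 \<le> (K1 + K2) * real n ^ (m - 1) * (ip_norm ip x)\<^sup>2"
    if "K \<in> {K1, K2}" for K n x
    using that K1(1) K2(1) by (intro mult_right_mono) auto
  show ?thesis
    unfolding power_growth_def
  proof (intro conjI exI[of _ "K1 + K2"] ballI allI impI inv)
    fix R and n :: nat and x assume "R \<in> {T, ?S}" and n: "n \<ge> 1"
    then consider "R = T" | "R = ?S" by blast
    then show "(ip_norm ip ((R ^^ n) x))\<^sup>2 \<le> (K1 + K2) * real n ^ (m - 1) * (ip_norm ip x)\<^sup>2"
    proof cases
      case 1
      show ?thesis unfolding 1 by (rule order.trans[OF K1(2)[OF n] mono]) simp
    next
      case 2
      show ?thesis unfolding 2 by (rule order.trans[OF K2(2)[OF n] mono]) simp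
    qed
  qed (use K1 K2 in simp)
qed

text \<open>The identity is bounded in both directions; the square roots undo the squares in
  \<open>linear_bounded\<close>.\<close>

lemma equivalent_norms_inner_product:
  assumes "complex_inner_product scale ip'"
  shows "equivalent_norms (ip_norm ip) (ip_norm ip')"
proof -
  interpret ip': finite_dim_inner_product scale Basis ip'
    by (rule other_inner_product[OF assms])
  have id: "Vector_Spaces.linear scale scale (\<lambda>x. x)" by (rule linear_ident)
  obtain C where C: "C > 0" "\<And>x. (ip_norm ip' x)\<^sup>2 \<le> C * (ip_norm ip x)\<^sup>2"
    using linear_bounded[OF assms id] by blast
  obtain D where D: "D > 0" "\<And>x. (ip_norm ip x)\<^sup>2 \<le> D * (ip_norm ip' x)\<^sup>2"
    using ip'.linear_bounded[OF complex_inner_product_axioms id] by blast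
  have "1 / sqrt D * ip_norm ip x \<le> ip_norm ip' x \<and> ip_norm ip' x \<le> sqrt C * ip_norm ip x" for x
  proof
    have "ip_norm ip x \<le> sqrt (D * (ip_norm ip' x)\<^sup>2)" using D(2) real_le_rsqrt by blast
    then show "1 / sqrt D * ip_norm ip x \<le> ip_norm ip' x"
      using D(1) by (simp add: real_sqrt_mult ip'.ip_norm_nonneg field_simps)
    have "ip_norm ip' x \<le> sqrt (C * (ip_norm ip x)\<^sup>2)" using C(2) real_le_rsqrt by blast
    then show "ip_norm ip' x \<le> sqrt C * ip_norm ip x"
      by (simp add: real_sqrt_mult ip_norm_nonneg)
  qed
  then show ?thesis
    unfolding equivalent_norms_def using C(1) D(1)
    by (intro exI[of _ "1 / sqrt D"] conjI exI[of _ "sqrt C"]) auto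
qed

text \<open>Changing the norm before and after applying the power costs the constant factors C and
  D, independent of n.\<close>

lemma power_growth_equivalent_norms:
  assumes "complex_inner_product scale ip'" "power_growth scale ip' p T"
  shows "power_growth scale ip p T"
proof -
  interpret ip': finite_dim_inner_product scale Basis ip'
    by (rule other_inner_product[OF assms(1)])
  have id: "Vector_Spaces.linear scale scale (\<lambda>x. x)" by (rule linear_ident)
  obtain C where C: "C > 0" "\<And>x. (ip_norm ip' x)\<^sup>2 \<le> C * (ip_norm ip x)\<^sup>2"
    using linear_bounded[OF assms(1) id] by blast
  obtain D where D: "D > 0" "\<And>x. (ip_norm ip x)\<^sup>2 \<le> D * (ip_norm ip' x)\<^sup>2"
    using ip'.linear_bounded[OF complex_inner_product_axioms id] by blast
  obtain K where K: "K \<ge> 0" "\<And>S n x. S \<in> {T, inv_into UNIV T} \<Longrightarrow> n \<ge> 1 \<Longrightarrow>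
      (ip_norm ip' ((S ^^ n) x))\<^sup>2 \<le> K * real n ^ p * (ip_norm ip' x)\<^sup>2"
    using assms(2) unfolding power_growth_def by blast
  have "(ip_norm ip ((S ^^ n) x))\<^sup>2 \<le> (D * K * C) * real n ^ p * (ip_norm ip x)\<^sup>2"
    if S: "S \<in> {T, inv_into UNIV T}" "n \<ge> 1" for S n x
  proof -
    have "(ip_norm ip ((S ^^ n) x))\<^sup>2 \<le> D * (ip_norm ip' ((S ^^ n) x))\<^sup>2" by (rule D)
    also have "\<dots> \<le> D * (K * real n ^ p * (ip_norm ip' x)\<^sup>2)"
      using K(2)[OF S] D(1) by (intro mult_left_mono) auto
    also have "\<dots> \<le> D * (K * real n ^ p * (C * (ip_norm ip x)\<^sup>2))"
      using C D(1) K(1) by (intro mult_left_mono) auto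
    finally show ?thesis by (simp add: mult_ac)
  qed
  moreover have "D * K * C \<ge> 0" using C(1) D(1) K(1) by simp
  ultimately show ?thesis
    using assms(2) unfolding power_growth_def by blast
qed

end

subsection \<open>Spectrum and Jordan blocks\<close>

lemma eigenvalue_in_spectrum:
  assumes "vector_space scale" "T x = scale z x" "x \<noteq> 0" "T 0 = 0"
  shows "z \<in> op_spectrum scale T"
proof (rule ccontr)
  interpret vector_space scale by fact
  assume "z \<notin> op_spectrum scale T"
  then have "inj (\<lambda>x. T x - scale z x)"
    using invertible_op_iff_bij[OF assms(1)] by (auto simp: op_spectrum_def bij_is_inj)
  from injD[OF this, of x 0] show False using assms by simp
qed

context finite_dim_inner_product
begin

text \<open>In finite dimension an injective linear map is bijective, so a spectral value makes the
  shifted operator lose injectivity.\<close>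

lemma spectrum_eigenvector:
  assumes T: "Vector_Spaces.linear scale scale T" and z: "z \<in> op_spectrum scale T"
  obtains x where "x \<noteq> 0" "T x = scale z x"
proof -
  interpret T: Vector_Spaces.linear scale scale T by fact
  have lin: "Vector_Spaces.linear scale scale (\<lambda>x. T x - scale z x)"
    unfolding Vector_Spaces.linear_iff using vector_space_axioms
    by (simp add: T.add T.scale scale_right_distrib scale_right_diff_distrib mult.commute)
  then have "\<not> bij (\<lambda>x. T x - scale z x)"
    using z by (simp add: op_spectrum_def invertible_op_iff_bij[OF vector_space_axioms])
  then have "\<exists>x. x \<noteq> 0 \<and> T x - scale z x = 0"
    using bij_if_trivial_kernel[OF lin] by blast
  then show ?thesis using that by auto
qed

text \<open>An eigenvector for z is an eigenvector of the inverse for 1/z. Polynomial growth along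
  it bounds both moduli by 1, which is why the condition must cover negative exponents.\<close>

lemma power_growth_spectrum:
  assumes "power_growth scale ip p T"
  shows "op_spectrum scale T \<subseteq> {z. cmod z = 1}"
proof
  fix z assume z: "z \<in> op_spectrum scale T"
  let ?S = "inv_into UNIV T"
  have inv: "invertible_op scale T" using assms by (simp add: power_growth_def)
  then have T: "Vector_Spaces.linear scale scale T" and bij: "bij T"
    by (simp_all add: invertible_op_iff_bij[OF vector_space_axioms])
  have S: "Vector_Spaces.linear scale scale ?S"
    using invertible_op_inv[OF vector_space_axioms inv] by (simp add: invertible_op_def)
  interpret T: Vector_Spaces.linear scale scale T by fact
  interpret S: Vector_Spaces.linear scale scale ?S by fact
  obtain x where x: "x \<noteq> 0" "T x = scale z x" by (rule spectrum_eigenvector[OF T z])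
  have z0: "z \<noteq> 0"
    using x bij T.inj_iff_eq_0 by (auto simp: bij_is_inj)
  have Sx: "?S x = scale (inverse z) x"
  proof -
    have "?S (T x) = scale z (?S x)" by (simp add: x(2) S.scale)
    then have "x = scale z (?S x)" using bij by (simp add: bij_is_inj)
    then have "scale (inverse z) x = scale (inverse z) (scale z (?S x))" by simp
    then show ?thesis using z0 by simp
  qed
  obtain K where K: "\<And>R n x. R \<in> {T, ?S} \<Longrightarrow> n \<ge> 1 \<Longrightarrow>
      (ip_norm ip ((R ^^ n) x))\<^sup>2 \<le> K * real n ^ p * (ip_norm ip x)\<^sup>2"
    using assms unfolding power_growth_def by blast
  have le1: "(cmod w)\<^sup>2 \<le> 1"
    if R: "R \<in> {T, ?S}" "Vector_Spaces.linear scale scale R" and Rx: "R x = scale w x" for R w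
  proof (rule power_bounded_by_power)
    fix n :: nat assume n: "n \<ge> 1"
    interpret R: Vector_Spaces.linear scale scale R by fact
    have "(R ^^ n) x = scale (w ^ n) x"
      by (induction n) (simp_all add: Rx R.scale mult.commute)
    then have "((cmod w)\<^sup>2) ^ n * (ip_norm ip x)\<^sup>2 \<le> K * real n ^ p * (ip_norm ip x)\<^sup>2"
      using K[OF R(1) n, of x] by (simp add: ip_norm_scale_sq norm_power mult.commute flip: power_mult)
    then show "((cmod w)\<^sup>2) ^ n \<le> K * real n ^ p"
      using ip_norm_pos[OF x(1)] by simp
  qed
  have "(cmod z)\<^sup>2 \<le> 1" using le1[OF _ T x(2)] by simp
  moreover have "(cmod (inverse z))\<^sup>2 \<le> 1" using le1[OF _ S Sx] by simp
  ultimately have "cmod z \<le> 1" "inverse (cmod z) \<le> 1"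
    by (simp_all add: norm_inverse abs_square_le_1 flip: power_inverse)
  then show "z \<in> {z. cmod z = 1}"
    using z0 by (simp add: field_simps)
qed

text \<open>An eigenvector of the Jordan matrix is pulled back along \<open>\<xi>\<close>, whose
  intertwining relation is used at n = 1.\<close>

lemma jordan_eigenvalue_in_spectrum:
  assumes T: "Vector_Spaces.linear scale scale T" and bs: "is_basis scale bs"
    and jnf: "jordan_nf (op_matrix scale bs T) n_as" and ka: "(k, a) \<in> set n_as"
  shows "a \<in> op_spectrum scale T"
proof -
  interpret T: Vector_Spaces.linear scale scale T by fact
  define N where "N = sum_list (map fst n_as)"
  obtain \<xi> where \<xi>: "bij_betw \<xi> UNIV (carrier_vec N)"
    "\<And>x y. \<xi> (x + y) = \<xi> x + \<xi> y" "\<And>c x. \<xi> (scale c x) = c \<cdot>\<^sub>v \<xi> x"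
    "\<And>x n. \<xi> ((T ^^ n) x) = (jordan_matrix n_as ^\<^sub>m n) *\<^sub>v \<xi> x" "\<xi> 0 = 0\<^sub>v N"
    using jordan_coordinates[OF vector_space_axioms bs T jnf] unfolding N_def by metis
  have k: "0 < k" using jnf ka by (force simp: jordan_nf_def)
  obtain v where v: "v \<in> carrier_vec N" "v \<noteq> 0\<^sub>v N" "jordan_matrix n_as *\<^sub>v v = a \<cdot>\<^sub>v v"
    using jordan_matrix_eigenvector[OF ka k] unfolding N_def by blast
  obtain x where x: "\<xi> x = v" using \<xi>(1) v(1) by (metis bij_betw_imp_surj_on imageE)
  have "\<xi> (T x) = \<xi> (scale a x)"
    using \<xi>(4)[of 1 x] v by (simp add: \<xi>(3) x)
  then have "T x = scale a x"
    using \<xi>(1) by (meson UNIV_I bij_betw_imp_inj_on inj_onD)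
  moreover have "x \<noteq> 0" using \<xi>(5) x v(2) by auto
  ultimately show ?thesis
    using eigenvalue_in_spectrum[OF vector_space_axioms] T.zero by blast
qed

text \<open>Apply T^n to the vector with coordinates e_j and read coordinate i: since |a| = 1, the
  modulus is exactly the binomial coefficient. Boundedness of that coordinate compares it with the
  norm of T^n x.\<close>

lemma power_growth_jordan_block:
  assumes growth: "power_growth scale ip (2 * r) T" and bs: "is_basis scale bs"
    and jnf: "jordan_nf (op_matrix scale bs T) n_as" and ka: "(k, a) \<in> set n_as"
  shows "k \<le> Suc r"
proof -
  have T: "Vector_Spaces.linear scale scale T"
    using growth by (simp add: power_growth_def invertible_op_def)
  have a: "cmod a = 1"
    using jordan_eigenvalue_in_spectrum[OF T bs jnf ka] power_growth_spectrum[OF growth] by blast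
  define N where "N = sum_list (map fst n_as)"
  obtain \<xi> where \<xi>: "bij_betw \<xi> UNIV (carrier_vec N)"
    "\<And>x y. \<xi> (x + y) = \<xi> x + \<xi> y" "\<And>c x. \<xi> (scale c x) = c \<cdot>\<^sub>v \<xi> x"
    "\<And>x n. \<xi> ((T ^^ n) x) = (jordan_matrix n_as ^\<^sub>m n) *\<^sub>v \<xi> x" "\<xi> 0 = 0\<^sub>v N"
    using jordan_coordinates[OF vector_space_axioms bs T jnf] unfolding N_def by metis
  have carr: "\<xi> x \<in> carrier_vec N" for x using \<xi>(1) by (auto simp: bij_betw_def)
  then have dim: "dim_vec (\<xi> x) = N" for x by (metis carrier_vecD)
  have k: "0 < k" using jnf ka by (force simp: jordan_nf_def)
  obtain i j where ij: "i < N" "j < N" "\<And>n. (jordan_matrix n_as ^\<^sub>m n) $$ (i, j)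
      = of_nat (n choose (k - 1)) * a ^ (n - (k - 1))"
    using jordan_matrix_pow_corner[OF ka k] unfolding N_def by blast
  obtain x where x: "\<xi> x = unit_vec N j"
    using \<xi>(1) by (metis bij_betw_imp_surj_on imageE unit_vec_carrier)
  obtain C where C: "C > 0" "\<And>y. cmod (\<xi> y $ i) \<le> C * ip_norm ip y"
    using functional_bounded[of "\<lambda>y. \<xi> y $ i"] ij(1) by (auto simp: \<xi>(2,3) dim)
  obtain K where K: "K \<ge> 0" "\<And>n. n \<ge> 1 \<Longrightarrow>
      (ip_norm ip ((T ^^ n) x))\<^sup>2 \<le> K * real n ^ (2 * r) * (ip_norm ip x)\<^sup>2"
    using growth unfolding power_growth_def by blast
  have "real (n choose (k - 1)) \<le> (C * sqrt K * ip_norm ip x) * real n ^ r" if n: "n \<ge> 1" for n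
  proof -
    have "\<xi> ((T ^^ n) x) $ i = (jordan_matrix n_as ^\<^sub>m n) $$ (i, j)"
      using ij(1,2) by (simp add: \<xi>(4) x mult_mat_vec_def N_def)
    then have "cmod (\<xi> ((T ^^ n) x) $ i) = real (n choose (k - 1))"
      using a by (simp add: ij(3) norm_mult norm_power)
    then have "real (n choose (k - 1)) \<le> C * ip_norm ip ((T ^^ n) x)"
      using C(2)[of "(T ^^ n) x"] by simp
    \<comment> \<open>Taking the root halves the exponent 2 * r, the point at which its evenness
      pays off.\<close>
    also have "ip_norm ip ((T ^^ n) x) \<le> sqrt (K * real n ^ (2 * r) * (ip_norm ip x)\<^sup>2)"
      using K(2)[OF n] by (rule real_le_rsqrt)
    also have "\<dots> = sqrt K * real n ^ r * ip_norm ip x"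
      by (simp add: real_sqrt_mult ip_norm_nonneg power_mult mult.commute[of 2 r])
    finally show ?thesis using C(1) by (simp add: mult_ac)
  qed
  then have "k - 1 \<le> r" by (rule binomial_bounded_by_power)
  then show ?thesis by simp
qed

lemma m_isometry_from_jordan_form:
  assumes T: "Vector_Spaces.linear scale scale T" and bs: "is_basis scale bs"
    and jnf: "jordan_nf (op_matrix scale bs T) n_as"
    and blocks: "\<And>k a. (k, a) \<in> set n_as \<Longrightarrow> cmod a = 1 \<and> k \<le> Suc r"
  shows "\<exists>ip'. complex_inner_product scale ip' \<and> m_isometry scale ip' (2 * r + 1) T"
proof -
  define N where "N = sum_list (map fst n_as)"
  obtain \<xi> where \<xi>: "bij_betw \<xi> UNIV (carrier_vec N)"
    "\<And>x y. \<xi> (x + y) = \<xi> x + \<xi> y" "\<And>c x. \<xi> (scale c x) = c \<cdot>\<^sub>v \<xi> x"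
    "\<And>x n. \<xi> ((T ^^ n) x) = (jordan_matrix n_as ^\<^sub>m n) *\<^sub>v \<xi> x" "\<xi> 0 = 0\<^sub>v N"
    using jordan_coordinates[OF vector_space_axioms bs T jnf] unfolding N_def by metis
  have carr: "\<xi> x \<in> carrier_vec N" for x using \<xi>(1) by (auto simp: bij_betw_def)
  then have dim: "dim_vec (\<xi> x) = N" for x by (metis carrier_vecD)
  define ip' where "ip' x y = (\<Sum>i<N. \<xi> x $ i * cnj (\<xi> y $ i))" for x y
  have ip': "complex_inner_product scale ip'"
  proof
    show "ip' (x + y) z = ip' x z + ip' y z" for x y z
      by (simp add: ip'_def \<xi>(2) dim algebra_simps sum.distrib)
    show "ip' (scale c x) y = c * ip' x y" for c x y
      by (simp add: ip'_def \<xi>(3) dim sum_distrib_left mult.assoc)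
    show "ip' y x = cnj (ip' x y)" for x y
      by (simp add: ip'_def mult.commute)
    show "0 < Re (ip' x x)" if "x \<noteq> 0" for x
    proof -
      have "\<xi> x \<noteq> \<xi> 0"
        using \<xi>(1) that by (meson UNIV_I bij_betw_imp_inj_on inj_onD)
      then obtain i where i: "i < N" "\<xi> x $ i \<noteq> 0"
        unfolding \<xi>(5) using dim[of x] by (metis eq_vecI index_zero_vec)
      have "Re (ip' x x) = (\<Sum>i<N. (cmod (\<xi> x $ i))\<^sup>2)"
        by (simp add: ip'_def flip: complex_norm_square)
      also have "\<dots> > 0"
        using i by (intro sum_pos2[of _ i]) auto
      finally show ?thesis .
    qed
  qed
  interpret ip': finite_dim_inner_product scale Basis ip'
    by (rule other_inner_product[OF ip'])
  \<comment> \<open>\<open>a\<close> is chosen before x, so two orbits share the same unimodular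
    factor in a given coordinate.\<close>
  have row: "\<exists>a. cmod a = 1 \<and> (\<forall>x. \<exists>p. degree p \<le> r \<and>
      (\<forall>n. \<xi> ((T ^^ n) x) $ i = a ^ n * poly p (of_nat n)))" if i: "i < N" for i
  proof -
    obtain a where a: "cmod a = 1" and "\<forall>j<N. \<exists>p. degree p \<le> r \<and>
        (\<forall>n. (jordan_matrix n_as ^\<^sub>m n) $$ (i, j) = a ^ n * poly p (of_nat n))"
      using jordan_matrix_pow_row[OF blocks] i unfolding N_def by blast
    then obtain p where p: "\<And>j. j < N \<Longrightarrow> degree (p j) \<le> r"
      "\<And>j n. j < N \<Longrightarrow> (jordan_matrix n_as ^\<^sub>m n) $$ (i, j) = a ^ n * poly (p j) (of_nat n)"
      by metis
    have "\<exists>q. degree q \<le> r \<and> (\<forall>n. \<xi> ((T ^^ n) x) $ i = a ^ n * poly q (of_nat n))" for x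
    proof (intro exI conjI allI)
      let ?q = "\<Sum>j<N. Polynomial.smult (\<xi> x $ j) (p j)"
      show "degree ?q \<le> r"
        using p(1) by (intro degree_sum_le) (auto intro: order.trans[OF degree_smult_le])
      fix n
      have "\<xi> ((T ^^ n) x) $ i = (\<Sum>j<N. (jordan_matrix n_as ^\<^sub>m n) $$ (i, j) * \<xi> x $ j)"
        using i by (simp add: \<xi>(4) scalar_prod_def dim N_def[symmetric] atLeast0LessThan)
      also have "\<dots> = (\<Sum>j<N. a ^ n * (\<xi> x $ j * poly (p j) (of_nat n)))"
        by (intro sum.cong refl) (simp add: p(2))
      finally show "\<xi> ((T ^^ n) x) $ i = a ^ n * poly ?q (of_nat n)"
        by (simp add: poly_sum sum_distrib_left)
    qed
    with a show ?thesis by blast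
  qed
  have "(fdiff ^^ (2 * r + 1)) (\<lambda>n. ip' ((T ^^ n) x) ((T ^^ n) y)) 0 = 0" for x y
  proof -
    have "\<exists>q. degree q \<le> 2 * r \<and>
        (\<forall>n. \<xi> ((T ^^ n) x) $ i * cnj (\<xi> ((T ^^ n) y) $ i) = poly q (of_nat n))" if i: "i < N" for i
    proof -
      obtain a p q where a: "cmod a = 1" and p: "degree p \<le> r"
        "\<And>n. \<xi> ((T ^^ n) x) $ i = a ^ n * poly p (of_nat n)"
        and q: "degree q \<le> r" "\<And>n. \<xi> ((T ^^ n) y) $ i = a ^ n * poly q (of_nat n)"
        using row[OF i] by metis
      \<comment> \<open>The powers of \<open>a\<close> cancel against their conjugates. As n is
        real, conjugating the other polynomial value amounts to conjugating its
        coefficients.\<close>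
      have "a * cnj a = 1" using a by (simp flip: complex_norm_square)
      then have "\<xi> ((T ^^ n) x) $ i * cnj (\<xi> ((T ^^ n) y) $ i) = poly (p * map_poly cnj q) (of_nat n)" for n
        unfolding p(2) q(2) using poly_cnj[of q "of_nat n"]
        by (simp add: mult_ac flip: power_mult_distrib)
      moreover have "degree (p * map_poly cnj q) \<le> 2 * r"
        using degree_mult_le[of p "map_poly cnj q"] degree_map_poly_le[of cnj q] p(1) q(1) by linarith
      ultimately show ?thesis by blast
    qed
    then obtain q where q: "\<And>i. i < N \<Longrightarrow> degree (q i) \<le> 2 * r"
      "\<And>i n. i < N \<Longrightarrow> \<xi> ((T ^^ n) x) $ i * cnj (\<xi> ((T ^^ n) y) $ i) = poly (q i) (of_nat n)"
      by metis
    have "(\<lambda>n. ip' ((T ^^ n) x) ((T ^^ n) y)) = (\<lambda>n. poly (\<Sum>i<N. q i) (of_nat n))"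
      by (simp add: ip'_def q(2) poly_sum)
    moreover have "degree (\<Sum>i<N. q i) \<le> 2 * r"
      using q(1) by (intro degree_sum_le) auto
    ultimately show ?thesis
      using fdiff_funpow_poly[of "\<Sum>i<N. q i" "2 * r + 1"] by simp
  qed
  then have "m_isometry scale ip' (2 * r + 1) T"
    using ip'.m_isometry_iff_fdiff[OF T] by blast
  with ip' show ?thesis by blast
qed

text \<open>\<open>Max\<close> is informative only on a finite set. Finiteness holds because the
  blocks of any normal form add up to the dimension.\<close>

lemma jordan_block_size_le_max:
  assumes T: "Vector_Spaces.linear scale scale T" and bs: "is_basis scale bs"
    and jnf: "jordan_nf (op_matrix scale bs T) n_as" and ka: "(k, a) \<in> set n_as"
  shows "k \<le> max_jordan_block_size scale T"
proof -
  have "l \<le> card Basis" if l: "l \<in> jordan_block_sizes scale T" for l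
  proof -
    obtain cs m_bs b where *: "is_basis scale cs" "jordan_nf (op_matrix scale cs T) m_bs" "(l, b) \<in> set m_bs"
      using l unfolding jordan_block_sizes_def by blast
    have "l \<le> sum_list (map fst m_bs)"
      using *(3) by (intro member_le_sum_list) (force, simp)
    also have "\<dots> = length cs"
      by (rule jordan_coordinates[OF vector_space_axioms *(1) T *(2)])
    also have "\<dots> = card Basis"
      by (rule is_basis_length[OF finite_dimensional_vector_space_axioms *(1)])
    finally show ?thesis .
  qed
  then have "finite (jordan_block_sizes scale T)"
    by (meson atMost_iff finite_atMost finite_subset subsetI)
  moreover have "k \<in> jordan_block_sizes scale T"
    unfolding jordan_block_sizes_def using assms by blast
  ultimately show ?thesis
    unfolding max_jordan_block_size_def by (intro Max_ge) auto
qed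

lemma m_isometry_if_jordan_condition:
  assumes T: "Vector_Spaces.linear scale scale T"
    and spec: "op_spectrum scale T \<subseteq> {z. cmod z = 1}"
    and size: "max_jordan_block_size scale T \<le> Suc r"
  shows "\<exists>ip'. complex_inner_product scale ip' \<and> m_isometry scale ip' (2 * r + 1) T"
proof -
  obtain bs where bs: "is_basis scale bs"
    using exists_basis_list[OF finite_dimensional_vector_space_axioms] by blast
  have A: "op_matrix scale bs T \<in> carrier_mat (length bs) (length bs)"
    by (simp add: op_matrix_def)
  obtain n_as where jnf: "jordan_nf (op_matrix scale bs T) n_as"
    using char_poly_factorized[OF A] jordan_nf_exists[OF A] by blast
  show ?thesis
  proof (rule m_isometry_from_jordan_form[OF T bs jnf], intro conjI)
    fix k a assume ka: "(k, a) \<in> set n_as"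
    show "cmod a = 1" using jordan_eigenvalue_in_spectrum[OF T bs jnf ka] spec by blast
    show "k \<le> Suc r" using jordan_block_size_le_max[OF T bs jnf ka] size by simp
  qed
qed

text \<open>The bound on each block of each form also gives the finiteness that \<open>Max\<close>
  requires.\<close>

lemma power_growth_max_jordan_block_size:
  assumes growth: "power_growth scale ip (2 * r) T"
  shows "max_jordan_block_size scale T \<le> Suc r"
proof -
  have le: "k \<le> Suc r" if "k \<in> jordan_block_sizes scale T" for k
    using that power_growth_jordan_block[OF growth] unfolding jordan_block_sizes_def by blast
  then have "finite (jordan_block_sizes scale T)"
    by (meson atMost_iff finite_atMost finite_subset subsetI)
  then show ?thesis
    unfolding max_jordan_block_size_def using le by simp
qed

subsection \<open>Similarity and change of inner product\<close>

lemma isometric_isomorphism: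
  assumes ip': "complex_inner_product scale ip'"
  obtains P where "invertible_op scale P" "\<And>x y. ip (P x) (P y) = ip' x y"
proof -
  interpret ip': finite_dim_inner_product scale Basis ip'
    by (rule other_inner_product[OF ip'])
  obtain E where E: "orthonormal E" "card E = card Basis"
    using orthonormal_basis by metis
  obtain F where F: "ip'.orthonormal F" "card F = card Basis" "\<And>x. (\<Sum>v\<in>F. scale (ip' x v) v) = x"
    using ip'.orthonormal_basis by metis
  have fin: "finite E" "finite F"
    using E(1) F(1) by (simp_all add: orthonormal_def ip'.orthonormal_def)
  obtain g where g: "bij_betw g F E"
    using finite_same_card_bij[OF fin(2,1)] E(2) F(2) by auto
  define P where "P x = (\<Sum>v\<in>F. scale (ip' x v) (g v))" for x
  have lin: "Vector_Spaces.linear scale scale P"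
    unfolding Vector_Spaces.linear_iff using vector_space_axioms
    by (simp add: P_def ip'.ip_add_left ip'.ip_scale_left scale_left_distrib sum.distrib scale_sum_right)
  have gg: "ip (g u) (g v) = of_bool (u = v)" if "u \<in> F" "v \<in> F" for u v
    using E(1) g that by (auto simp: orthonormal_def bij_betw_def inj_on_eq_iff)
  have iso: "ip (P x) (P y) = ip' x y" for x y
  proof -
    have "ip (P x) (P y) = (\<Sum>u\<in>F. \<Sum>v\<in>F. ip' x u * cnj (ip' y v) * ip (g u) (g v))"
      by (simp only: P_def ip_sum_left ip_scale_left)
        (simp add: ip_sum_right ip_scale_right sum_distrib_left mult.assoc)
    also have "\<dots> = (\<Sum>u\<in>F. \<Sum>v\<in>F. if u = v then ip' x u * cnj (ip' y v) else 0)"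
      by (intro sum.cong refl) (simp add: gg)
    also have "\<dots> = (\<Sum>u\<in>F. ip' x u * ip' u y)"
      using fin(2) by (simp flip: ip'.ip_commute)
    also have "\<dots> = ip' (\<Sum>u\<in>F. scale (ip' x u) u) y"
      by (simp add: ip'.ip_sum_left ip'.ip_scale_left)
    finally show ?thesis by (simp add: F(3))
  qed
  \<comment> \<open>\<open>P\<close> preserves the form, hence the norm, so its kernel is
    trivial.\<close>
  have "x = 0" if "P x = 0" for x
    using iso[of x x] that ip'.ip_pos[of x] by fastforce
  then have "bij P" by (rule bij_if_trivial_kernel[OF lin])
  then have "invertible_op scale P"
    using lin by (simp add: invertible_op_iff_bij[OF vector_space_axioms])
  then show ?thesis by (rule that[OF _ iso])
qed

text \<open>\<open>P\<close> intertwines all iterates, so it carries the form along orbits of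
  \<open>T\<close> to the form along orbits of \<open>A\<close>; surjectivity ensures that every
  orbit of \<open>A\<close> arises.\<close>

lemma m_isometry_conjugate:
  assumes P: "invertible_op scale P" and iso: "\<And>x y. ip (P x) (P y) = ip' x y"
    and ip': "complex_inner_product scale ip'"
    and T: "Vector_Spaces.linear scale scale T" and A: "Vector_Spaces.linear scale scale A"
    and PT: "\<And>x. P (T x) = A (P x)"
  shows "m_isometry scale ip m A \<longleftrightarrow> m_isometry scale ip' m T"
proof -
  interpret ip': finite_dim_inner_product scale Basis ip'
    by (rule other_inner_product[OF ip'])
  have surj: "surj P"
    using P by (simp add: invertible_op_iff_bij[OF vector_space_axioms] bij_is_surj)
  have pow: "P ((T ^^ n) x) = (A ^^ n) (P x)" for n x
    by (induction n) (simp_all add: PT)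
  have "(\<forall>x y. (fdiff ^^ m) (\<lambda>n. ip ((A ^^ n) x) ((A ^^ n) y)) 0 = 0) \<longleftrightarrow>
      (\<forall>x y. (fdiff ^^ m) (\<lambda>n. ip ((A ^^ n) (P x)) ((A ^^ n) (P y))) 0 = 0)"
  proof (intro iffI allI)
    fix x y assume *: "\<forall>x y. (fdiff ^^ m) (\<lambda>n. ip ((A ^^ n) (P x)) ((A ^^ n) (P y))) 0 = 0"
    obtain u v where "x = P u" "y = P v" using surj by (meson surjD)
    then show "(fdiff ^^ m) (\<lambda>n. ip ((A ^^ n) x) ((A ^^ n) y)) 0 = 0" using * by simp
  qed simp
  also have "\<dots> \<longleftrightarrow> (\<forall>x y. (fdiff ^^ m) (\<lambda>n. ip' ((T ^^ n) x) ((T ^^ n) y)) 0 = 0)"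
    by (simp add: iso flip: pow)
  finally show ?thesis
    by (simp add: m_isometry_iff_fdiff[OF A] ip'.m_isometry_iff_fdiff[OF T])
qed

text \<open>A similarity pulls \<open>ip\<close> back along \<open>P\<close>. Conversely a new inner
  product yields an isometric \<open>P\<close> onto \<open>ip\<close>, and P T P^-1 is the required
  operator.\<close>

lemma similar_to_m_isometry_iff:
  assumes T: "Vector_Spaces.linear scale scale T"
  shows "(\<exists>A. m_isometry scale ip m A \<and> similar_op scale T A) \<longleftrightarrow>
    (\<exists>ip'. complex_inner_product scale ip' \<and> m_isometry scale ip' m T)"
proof
  assume "\<exists>A. m_isometry scale ip m A \<and> similar_op scale T A"
  then obtain A P where A: "m_isometry scale ip m A" and P: "invertible_op scale P"
    and sim: "T = inv_into UNIV P \<circ> A \<circ> P"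
    unfolding similar_op_def by blast
  have linP: "Vector_Spaces.linear scale scale P" and bij: "bij P"
    using P by (simp_all add: invertible_op_iff_bij[OF vector_space_axioms])
  interpret P: Vector_Spaces.linear scale scale P by fact
  define ip' where "ip' x y = ip (P x) (P y)" for x y
  have ip': "complex_inner_product scale ip'"
  proof
    show "0 < Re (ip' x x)" if "x \<noteq> 0" for x
      unfolding ip'_def using that bij P.inj_iff_eq_0 by (intro ip_pos) (auto simp: bij_is_inj)
    show "ip' y x = cnj (ip' x y)" for x y
      unfolding ip'_def by (rule ip_commute)
  qed (simp_all add: ip'_def P.add P.scale ip_add_left ip_scale_left)
  have PT: "P (T x) = A (P x)" for x
    using bij by (simp add: sim bij_is_surj surj_f_inv_f)
  have linA: "Vector_Spaces.linear scale scale A"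
    using A by (simp add: m_isometry_def)
  have "m_isometry scale ip m A \<longleftrightarrow> m_isometry scale ip' m T"
    by (rule m_isometry_conjugate[OF P _ ip' T linA PT]) (simp add: ip'_def)
  then have "m_isometry scale ip' m T" using A by simp
  then show "\<exists>ip'. complex_inner_product scale ip' \<and> m_isometry scale ip' m T"
    using ip' by blast
next
  assume "\<exists>ip'. complex_inner_product scale ip' \<and> m_isometry scale ip' m T"
  then obtain ip' where ip': "complex_inner_product scale ip'" and iso: "m_isometry scale ip' m T"
    by blast
  obtain P where P: "invertible_op scale P" "\<And>x y. ip (P x) (P y) = ip' x y"
    using isometric_isomorphism[OF ip'] by blast
  have linP: "Vector_Spaces.linear scale scale P" and bij: "bij P"
    using P by (simp_all add: invertible_op_iff_bij[OF vector_space_axioms])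
  define A where "A = P \<circ> T \<circ> inv_into UNIV P"
  have inv: "inv_into UNIV P (P x) = x" for x
    using bij by (simp add: bij_is_inj)
  have "Vector_Spaces.linear scale scale (inv_into UNIV P)"
    using invertible_op_inv[OF vector_space_axioms P(1)] by (simp add: invertible_op_def)
  then have A: "Vector_Spaces.linear scale scale A"
    unfolding A_def using T linP by (blast intro: Vector_Spaces.linear_compose)
  have "m_isometry scale ip m A"
    using m_isometry_conjugate[OF P ip' T A] iso by (simp add: A_def inv)
  moreover have "T = inv_into UNIV P \<circ> A \<circ> P"
    by (simp add: A_def fun_eq_iff inv)
  ultimately show "\<exists>A. m_isometry scale ip m A \<and> similar_op scale T A"
    unfolding similar_op_def using P(1) by blast
qed

end

theorem theorem5p2:
  fixes scale :: "complex \<Rightarrow> 'a::ab_group_add \<Rightarrow> 'a"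
    and Basis :: "'a set"
    and ip :: "'a \<Rightarrow> 'a \<Rightarrow> complex"
    and T :: "'a \<Rightarrow> 'a"
    and m :: nat
  assumes "finite_dimensional_vector_space scale Basis"
    and "complex_inner_product scale ip"
    and "Vector_Spaces.linear scale scale T"
    and "m \<ge> 1" and "odd m"
  shows "let
      a = (\<exists>A. m_isometry scale ip m A \<and> similar_op scale T A);
      b = (\<exists>ip'. complex_inner_product scale ip' \<and>
             equivalent_norms (ip_norm ip) (ip_norm ip') \<and> m_isometry scale ip' m T);
      c = (invertible_op scale T \<and>
             (SUP n\<in>UNIV - {0::int}.
                ereal ((op_norm ip (op_powi T n))\<^sup>2 / real_of_int \<bar>n\<bar> ^ (m - 1))) < \<infinity>);
      d = (op_spectrum scale T \<subseteq> {z. cmod z = 1} \<and>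
             max_jordan_block_size scale T \<le> (m + 1) div 2)
    in (a \<longleftrightarrow> b) \<and> (b \<longleftrightarrow> c) \<and> (c \<longleftrightarrow> d)"
proof -
  interpret finite_dim_inner_product scale Basis ip
    using assms(1,2) by (simp add: finite_dim_inner_product_def)
  obtain r where m: "m = 2 * r + 1" using \<open>odd m\<close> by (rule oddE)
  \<comment> \<open>The equivalence of norms is left out of \<open>?b\<close> and restored by the
    fact \<open>b\<close> below.\<close>
  let ?b = "\<exists>ip'. complex_inner_product scale ip' \<and> m_isometry scale ip' m T"
  have bc: "power_growth scale ip (2 * r) T" if b: ?b
  proof -
    obtain ip' where ip': "complex_inner_product scale ip'" "m_isometry scale ip' m T"
      using b by blast
    interpret ip': finite_dim_inner_product scale Basis ip'
      by (rule other_inner_product[OF ip'(1)])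
    show ?thesis
      \<comment> \<open>Growth is first found in the norm in which \<open>T\<close> is an
        m-isometry, then transferred to the given one.\<close>
      using power_growth_equivalent_norms[OF ip'(1)] ip'.m_isometry_power_growth[OF ip'(2)] by (simp add: m)
  qed
  have cd: "op_spectrum scale T \<subseteq> {z. cmod z = 1} \<and> max_jordan_block_size scale T \<le> Suc r"
    if "power_growth scale ip (2 * r) T"
    using that power_growth_spectrum power_growth_max_jordan_block_size by blast
  have db: ?b if "op_spectrum scale T \<subseteq> {z. cmod z = 1} \<and> max_jordan_block_size scale T \<le> Suc r"
    using that m_isometry_if_jordan_condition[OF assms(3)] by (simp add: m)
  have b: "?b \<longleftrightarrow> (\<exists>ip'. complex_inner_product scale ip' \<and>
      equivalent_norms (ip_norm ip) (ip_norm ip') \<and> m_isometry scale ip' m T)"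
    using equivalent_norms_inner_product by blast
  have m_eqs: "(m + 1) div 2 = Suc r" "m - 1 = 2 * r" by (simp_all add: m)
  show ?thesis
    unfolding Let_def sup_finite_iff_power_growth similar_to_m_isometry_iff[OF assms(3)] m_eqs
      b[symmetric]
    using bc cd db by blast
qed

end
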